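(* Let $N$ be a positive integer and let $H$ be a subgroup of $(\mathbb{Z}/N\mathbb{Z})^\times$. Let $K_H$ be the minimal multiple of $s_Nt_N$ dividing $N$ such that the kernel of the projection from $(\mathbb{Z}/N\mathbb{Z})^\times$ to $(\mathbb{Z}/K_H\mathbb{Z})^\times$ is contained in $H$. Let $\eta_H$ be the $\gcd$ of all the differences $e-h$ where $e$ and $h$ are integers that map to elements of $H$ that are mutual inverses, and let $\sigma_H=\gcd\{\frac{N}{K_H},\eta_H\}$. Then the normalizer of $\Gamma_H$ in $SL_2(\mathbb{R})$ is contained in $\Gamma_0^{*,\sigma_H}(N)$. More precisely, this normalizer consists of those elements $\begin{pmatrix} a\sqrt{\mu} & b/\sqrt{\mu}\\ c\frac{N}{\mu}\sqrt{\mu} & d\sqrt{\mu}\end{pmatrix}$ of $\Gamma_0^{*,\sigma_H}(N)$ such that whenever integers $e$ and $h$ represent elements of $H$ that are inverse to each other, the residues of $ade\mu-bch\frac{N}{\mu}$ and $adh\mu-bce\frac{N}{\mu}$ modulo $N$ are also elements of $H$ that are inverse to each other.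
   Context: For a positive integer $M$, write uniquely $M=s_M^2t_M$ with $s_M,t_M$ positive integers and $t_M$ square-free. A positive divisor $\mu$ of $N$ is exact if $\gcd(\mu,N/\mu)=1$. $\Gamma_0^{*,s_N}(N)$ is the set of $A\in SL_2(\mathbb{R})$ admitting a presentation $A=\begin{pmatrix} a\sqrt{\mu} & b/\sqrt{\mu}\\ c\frac{N}{\mu}\sqrt{\mu} & d\sqrt{\mu}\end{pmatrix}$ with $\mu$ an exact divisor of $N$, $a,d\in\frac{1}{s_\mu}\mathbb{Z}$ and $b,c\in\frac{1}{s_{N/\mu}}\mathbb{Z}$. A presentation is cancelation-free if in each of the products $ab,ac,bd,cd$ of rational numbers in lowest terms no cancelation occurs (the denominator of the product is the product of the denominators); every element of $\Gamma_0^{*,s_N}(N)$ has such a presentation. For a positive divisor $\sigma$ of $s_N$, $\Gamma_0^{*,\sigma}(N)$ is the set of $A\in\Gamma_0^{*,s_N}(N)$ such that in a cancelation-free presentation $a,b,c,d\in\frac{1}{\sigma}\mathbb{Z}$ (equivalently, $\sigma ab,\sigma cd\in\mathbb{Z}$ in any presentation). The numbers $ad\mu$ and $bc\frac{N}{\mu}$ are integers independent of the presentation. $\Gamma_0(N)$ is the group of matrices in $SL_2(\mathbb{Z})$ with lower left entry divisible by $N$. For a subgroup $H\subseteq(\mathbb{Z}/N\mathbb{Z})^\times$, $\Gamma_H$ is the group of matrices in $\Gamma_0(N)$ whose diagonal entries reduce modulo $N$ to elements of $H$. *)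

theory Defs
  imports
    "HOL-Analysis.Analysis"
    "HOL-Computational_Algebra.Squarefree"
    "HOL-Algebra.IntRing"
    "HOL-Algebra.Group_Action"
begin

definition SL2R :: "(real^2^2) monoid" where
  "SL2R = \<lparr>carrier = {A. det A = 1}, mult = (**), one = mat 1\<rparr>"

lemma group_SL2R: "group SL2R"
proof (rule groupI)
  show "\<exists>B\<in>carrier SL2R. B \<otimes>\<^bsub>SL2R\<^esub> A = \<one>\<^bsub>SL2R\<^esub>" if "A \<in> carrier SL2R" for A
  proof -
    have "det A = 1" using that by (simp add: SL2R_def)
    then have "invertible A" by (simp add: invertible_det_nz)
    then obtain B where B: "B ** A = mat 1" by (auto simp: invertible_def)
    then have "det B * det A = 1" by (metis det_mul det_I)
    then show ?thesis using B \<open>det A = 1\<close> by (auto simp: SL2R_def)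
  qed
qed (auto simp: SL2R_def det_mul matrix_mul_assoc)

definition mat2 :: "real \<Rightarrow> real \<Rightarrow> real \<Rightarrow> real \<Rightarrow> real^2^2" where
  "mat2 p q r s = vector [vector [p, q], vector [r, s]]"

text \<open>In the decomposition of a positive integer as \<open>M = s\<^sup>2 t\<close> with \<open>t\<close> square-free, \<open>s\<close> is
  \<^const>\<open>square_part\<close> (not its square) and \<open>t\<close> is \<^const>\<open>squarefree_part\<close>;
  see \<open>squarefree_decompose\<close> and \<open>squarefree_decomposition_unique\<close>.\<close>

definition exact_divisor :: "nat \<Rightarrow> nat \<Rightarrow> bool" where
  "exact_divisor \<mu> N \<longleftrightarrow> \<mu> dvd N \<and> coprime \<mu> (N div \<mu>)"

text \<open>For \<open>s > 0\<close>: the rational number \<open>x\<close> lies in \<open>(1/s)\<int>\<close>.\<close>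

definition in_frac :: "nat \<Rightarrow> rat \<Rightarrow> bool" where
  "in_frac s x \<longleftrightarrow> of_nat s * x \<in> \<int>"

definition is_presentation ::
    "nat \<Rightarrow> real^2^2 \<Rightarrow> nat \<Rightarrow> rat \<Rightarrow> rat \<Rightarrow> rat \<Rightarrow> rat \<Rightarrow> bool" where
  "is_presentation N A \<mu> a b c d \<longleftrightarrow>
     exact_divisor \<mu> N \<and>
     in_frac (square_part \<mu>) a \<and> in_frac (square_part \<mu>) d \<and>
     in_frac (square_part (N div \<mu>)) b \<and> in_frac (square_part (N div \<mu>)) c \<and>
     A = mat2 (of_rat a * sqrt (real \<mu>)) (of_rat b / sqrt (real \<mu>))
              (of_rat c * real (N div \<mu>) * sqrt (real \<mu>)) (of_rat d * sqrt (real \<mu>))"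

definition rat_denom :: "rat \<Rightarrow> int" where
  "rat_denom x = snd (quotient_of x)"

definition no_cancelation :: "rat \<Rightarrow> rat \<Rightarrow> bool" where
  "no_cancelation x y \<longleftrightarrow> rat_denom (x * y) = rat_denom x * rat_denom y"

definition cancelation_free :: "rat \<Rightarrow> rat \<Rightarrow> rat \<Rightarrow> rat \<Rightarrow> bool" where
  "cancelation_free a b c d \<longleftrightarrow>
     no_cancelation a b \<and> no_cancelation a c \<and> no_cancelation b d \<and> no_cancelation c d"

definition Gamma0_star_full :: "nat \<Rightarrow> (real^2^2) set" where
  "Gamma0_star_full N =
     {A \<in> carrier SL2R. \<exists>\<mu> a b c d. is_presentation N A \<mu> a b c d}"

definition Gamma0_star :: "nat \<Rightarrow> nat \<Rightarrow> (real^2^2) set" where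
  "Gamma0_star N \<sigma> =
     {A \<in> Gamma0_star_full N. \<exists>\<mu> a b c d. is_presentation N A \<mu> a b c d \<and>
        cancelation_free a b c d \<and>
        in_frac \<sigma> a \<and> in_frac \<sigma> b \<and> in_frac \<sigma> c \<and> in_frac \<sigma> d}"

text \<open>The group \<open>(\<int>/N\<int>)\<^sup>\<times>\<close>. Its elements are cosets, i.e. sets of integers. (The ring
  \<open>residue_ring\<close> of HOL-Number_Theory is unsuitable, since it is not a ring for \<open>N = 1\<close>.)\<close>

abbreviation residue_units :: "nat \<Rightarrow> int set monoid" where
  "residue_units N \<equiv> units_of (ZFact (int N))"

definition residue_class :: "nat \<Rightarrow> int \<Rightarrow> int set" where
  "residue_class N e = Idl\<^bsub>\<Z>\<^esub> {int N} +>\<^bsub>\<Z>\<^esub> e"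

text \<open>For \<open>K\<close> dividing \<open>N\<close>, the projection \<open>\<int>/N\<int> \<rightarrow> \<int>/K\<int>\<close> sends
  \<open>e + N\<int>\<close> to \<open>(e + N\<int>) + K\<int> = e + K\<int>\<close>.\<close>

definition residue_proj :: "nat \<Rightarrow> int set \<Rightarrow> int set" where
  "residue_proj K X = Idl\<^bsub>\<Z>\<^esub> {int K} <+>\<^bsub>\<Z>\<^esub> X"

definition Gamma0 :: "nat \<Rightarrow> (real^2^2) set" where
  "Gamma0 N = {mat2 (of_int a) (of_int b) (of_int c) (of_int d) | a b c d :: int.
                 a * d - b * c = 1 \<and> int N dvd c}"

definition Gamma_H :: "nat \<Rightarrow> int set set \<Rightarrow> (real^2^2) set" where
  "Gamma_H N H =
     {A \<in> Gamma0 N. \<exists>a d :: int. A $ 1 $ 1 = of_int a \<and> A $ 2 $ 2 = of_int d \<and>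
        residue_class N a \<in> H \<and> residue_class N d \<in> H}"

definition inverse_reps :: "nat \<Rightarrow> int set set \<Rightarrow> int \<Rightarrow> int \<Rightarrow> bool" where
  "inverse_reps N H e h \<longleftrightarrow>
     residue_class N e \<in> H \<and> residue_class N h \<in> H \<and>
     residue_class N e \<otimes>\<^bsub>residue_units N\<^esub> residue_class N h = \<one>\<^bsub>residue_units N\<^esub>"

definition K_H :: "nat \<Rightarrow> int set set \<Rightarrow> nat" where
  "K_H N H = (LEAST K. square_part N * squarefree_part N dvd K \<and> K dvd N \<and>
                kernel (residue_units N) (residue_units K) (residue_proj K) \<subseteq> H)"

definition eta_H :: "nat \<Rightarrow> int set set \<Rightarrow> int" where
  "eta_H N H = Gcd {e - h | e h. inverse_reps N H e h}"

definition sigma_H :: "nat \<Rightarrow> int set set \<Rightarrow> nat" where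
  "sigma_H N H = gcd (N div K_H N H) (nat (eta_H N H))"

end

theory Submission
  imports Defs "HOL-Number_Theory.Cong" "HOL-Computational_Algebra.Nth_Powers"
begin

text \<open>
  Let \<open>A\<close> have rows \<open>(\<alpha>, \<beta>)\<close> and \<open>(\<gamma>, \<delta>)\<close>. If \<open>A\<close> normalizes \<open>\<Gamma>\<^sub>H\<close>, conjugating the unipotent elements of
  \<open>\<Gamma>\<^sub>H\<close> by \<open>A\<close> and by its inverse shows that \<open>\<alpha>\<^sup>2\<close>, \<open>\<delta>\<^sup>2\<close>, \<open>\<beta>\<^sup>2N\<close>, \<open>\<gamma>\<^sup>2/N\<close>, \<open>\<alpha>\<gamma>\<close>, \<open>\<beta>\<delta>N\<close> are integers and that
  \<open>1 + j\<gamma>\<delta>\<close> and \<open>1 + j\<alpha>\<beta>N\<close> represent elements of \<open>H\<close> for all integers \<open>j\<close>. As \<open>(\<gamma>\<delta>)\<^sup>2\<close> and \<open>(\<alpha>\<beta>N)\<^sup>2\<close> are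
  multiples of \<open>N\<close>, both \<open>\<gamma>\<delta>\<close> and \<open>\<alpha>\<beta>N\<close> are multiples of \<open>s\<^sub>N t\<^sub>N\<close>, and then of \<open>K\<^sub>H\<close>, because the moduli
  admissible in the definition of \<open>K\<^sub>H\<close> are closed under gcd. Conjugating a matrix with diagonal
  \<open>e, h\<close> gives integrality of \<open>\<alpha>\<beta>(e - h)\<close> and \<open>\<gamma>\<delta>(e - h)/N\<close>. Together these yield the bound \<open>\<sigma>\<^sub>H\<close> on the
  denominators.

  Conversely, the diagonal entries of a conjugate of such a matrix by an element of
  \<open>\<Gamma>\<^sub>0\<^sup>*\<^sup>,\<^sup>\<sigma>(N)\<close>, \<open>\<sigma> = \<sigma>\<^sub>H\<close>, are \<open>e' = \<alpha>\<delta>e - \<beta>\<gamma>h\<close> and \<open>h' = \<alpha>\<delta>h - \<beta>\<gamma>e\<close> up to multiples of \<open>K\<^sub>H\<close>, which do not affect membership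
  in \<open>H\<close>, and \<open>e'h' = eh - \<alpha>\<delta>\<beta>\<gamma>(e - h)\<^sup>2\<close> is \<open>1\<close> modulo \<open>N\<close>.
\<close>

subsection \<open>Conjugation of two-by-two matrices\<close>

text \<open>The normalizer is defined by equality of the conjugate of \<open>S\<close> with
  \<open>S\<close>. Stability under \<open>g\<close> alone would allow a proper subset as conjugate;
  stability under \<open>inv g\<close> supplies the other inclusion.\<close>

lemma (in group) mem_normalizer_iff:
  assumes S: "S \<subseteq> carrier G"
  shows "g \<in> normalizer G S \<longleftrightarrow> g \<in> carrier G \<and> (\<forall>x\<in>S. g \<otimes> x \<otimes> inv g \<in> S \<and> inv g \<otimes> x \<otimes> g \<in> S)"
    (is "_ \<longleftrightarrow> _ \<and> ?R")
proof (cases "g \<in> carrier G")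
  case True
  have conj: "(g <# S) #> inv g = (\<lambda>x. g \<otimes> x \<otimes> inv g) ` S"
    by (auto simp: l_coset_def r_coset_def)
  have "(\<lambda>x. g \<otimes> x \<otimes> inv g) ` S = S \<longleftrightarrow> ?R"
  proof
    assume eq: "(\<lambda>x. g \<otimes> x \<otimes> inv g) ` S = S"
    show ?R
    proof
      fix x assume x: "x \<in> S"
      then obtain y where y: "y \<in> S" "x = g \<otimes> y \<otimes> inv g" using eq by blast
      have "y \<in> carrier G" using y S by auto
      then have "inv g \<otimes> x \<otimes> g = y" using y(2) True by (simp add: m_assoc) (simp add: m_assoc[symmetric])
      then show "g \<otimes> x \<otimes> inv g \<in> S \<and> inv g \<otimes> x \<otimes> g \<in> S" using eq x y by auto
    qed
  next
    assume R: ?R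
    have "x \<in> (\<lambda>x. g \<otimes> x \<otimes> inv g) ` S" if x: "x \<in> S" for x
    proof
      have "x \<in> carrier G" using x S by auto
      then show "x = g \<otimes> (inv g \<otimes> x \<otimes> g) \<otimes> inv g"
        using True by (simp add: m_assoc) (simp add: m_assoc[symmetric])
      show "inv g \<otimes> x \<otimes> g \<in> S" using R x by auto
    qed
    then show "(\<lambda>x. g \<otimes> x \<otimes> inv g) ` S = S" using R by auto
  qed
  then show ?thesis using True S conj by (simp add: normalizer_def stabilizer_def)
qed (simp add: normalizer_def stabilizer_def)

lemma mat2_mult:
  "mat2 a b c d ** mat2 e f g h = mat2 (a*e + b*g) (a*f + b*h) (c*e + d*g) (c*f + d*h)"
  by (simp add: mat2_def matrix_matrix_mult_def vec_eq_iff forall_2 sum_2)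

lemma mat2_eq_iff: "mat2 a b c d = mat2 e f g h \<longleftrightarrow> a = e \<and> b = f \<and> c = g \<and> d = h"
  by (simp add: mat2_def vec_eq_iff forall_2)

lemma mat2_exhaust: obtains a b c d where "A = mat2 a b c d"
proof
  show "A = mat2 (A$1$1) (A$1$2) (A$2$1) (A$2$2)"
    by (simp add: mat2_def vec_eq_iff forall_2)
qed

lemma mat2_in_SL2R_iff: "mat2 a b c d \<in> carrier SL2R \<longleftrightarrow> a * d - b * c = 1"
  by (simp add: SL2R_def mat2_def det_2)

lemma mat2_inv:
  assumes "a * d - b * c = 1"
  shows "inv\<^bsub>SL2R\<^esub> (mat2 a b c d) = mat2 d (- b) (- c) a"
proof (rule group.inv_equality[OF group_SL2R])
  show "mat2 d (- b) (- c) a \<otimes>\<^bsub>SL2R\<^esub> mat2 a b c d = \<one>\<^bsub>SL2R\<^esub>"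
    using assms
    by (simp add: SL2R_def mat2_mult)
      (simp add: mat2_def mat_def vec_eq_iff forall_2 algebra_simps)
qed (use assms in \<open>auto simp: mat2_in_SL2R_iff algebra_simps\<close>)

text \<open>The entries are grouped by the quadratic monomials in \<alpha>, \<beta>, \<gamma>,
  \<delta>, since the integrality of these monomials is what is later extracted.\<close>

lemma mat2_conj:
  "mat2 \<alpha> \<beta> \<gamma> \<delta> ** mat2 e f g h ** mat2 \<delta> (- \<beta>) (- \<gamma>) \<alpha> =
     mat2 (\<alpha>*\<delta>*e - \<beta>*\<gamma>*h + \<beta>*\<delta>*g - \<alpha>*\<gamma>*f) (\<alpha>*\<beta>*(h - e) + \<alpha>\<^sup>2*f - \<beta>\<^sup>2*g)
          (\<gamma>*\<delta>*(e - h) + \<delta>\<^sup>2*g - \<gamma>\<^sup>2*f) (\<alpha>*\<delta>*h - \<beta>*\<gamma>*e + \<alpha>*\<gamma>*f - \<beta>*\<delta>*g)"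
  by (simp add: mat2_mult mat2_eq_iff algebra_simps power2_eq_square)

subsection \<open>Residue classes\<close>

lemma residue_class_ZMod: "residue_class N e = ZMod (int N) e"
  by (simp add: residue_class_def ZMod_def)

lemma residue_class_eq_iff: "residue_class N e = residue_class N h \<longleftrightarrow> [e = h] (mod int N)"
  by (simp add: residue_class_ZMod ZMod_eq_mod cong_def)

lemma carrier_ZFact: "carrier (ZFact (int N)) = range (residue_class N)"
  by (auto simp: ZFact_def FactRing_def A_RCOSETS_defs a_r_coset_def residue_class_def)

lemma residue_class_mult:
  "residue_class N e \<otimes>\<^bsub>residue_units N\<^esub> residue_class N h = residue_class N (e * h)"
proof -
  interpret ideal "Idl\<^bsub>\<Z>\<^esub> {int N}" \<Z>
    by (rule int.genideal_ideal) simp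
  show ?thesis
    using rcoset_mult_add[of e h]
    by (simp add: units_of_def ZFact_def FactRing_def residue_class_def)
qed

lemma residue_units_one: "\<one>\<^bsub>residue_units N\<^esub> = residue_class N 1"
  by (simp add: units_of_def ZFact_def FactRing_def residue_class_def)

lemma residue_class_unit_iff:
  "residue_class N e \<in> carrier (residue_units N) \<longleftrightarrow> coprime e (int N)"
proof -
  interpret cring "ZFact (int N)" by (rule ZFact_is_cring)
  have *: "residue_class N e \<otimes>\<^bsub>ZFact (int N)\<^esub> residue_class N h = \<one>\<^bsub>ZFact (int N)\<^esub>
     \<longleftrightarrow> [e * h = 1] (mod int N)" for h
    using residue_class_mult[of N e h] residue_units_one[of N]
    by (simp add: units_of_mult units_of_one residue_class_eq_iff)
  have "residue_class N e \<in> Units (ZFact (int N)) \<longleftrightarrow> (\<exists>h. [e * h = 1] (mod int N))"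
    unfolding Units_def using * by (auto simp: carrier_ZFact m_comm)
  then show ?thesis
    by (simp add: units_of_carrier coprime_iff_invertible_int)
qed

lemma residue_units_carrier:
  "carrier (residue_units N) = residue_class N ` {e. coprime e (int N)}"
proof -
  have "carrier (residue_units N) \<subseteq> range (residue_class N)"
    by (auto simp: units_of_carrier Units_def carrier_ZFact)
  then show ?thesis using residue_class_unit_iff by auto
qed

lemma residue_class_mem_iff: "x \<in> residue_class N e \<longleftrightarrow> [x = e] (mod int N)"
proof -
  have "x \<in> residue_class N e \<longleftrightarrow> (\<exists>k. x = k * int N + e)"
    by (auto simp: residue_class_def a_r_coset_defs int_Idl)
  also have "\<dots> \<longleftrightarrow> int N dvd x - e"
    by (auto simp: dvd_def algebra_simps)
  finally show ?thesis by (simp add: cong_iff_dvd_diff)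
qed

lemma residue_proj_class:
  assumes "K dvd N"
  shows "residue_proj K (residue_class N e) = residue_class K e"
proof -
  have "x \<in> residue_proj K (residue_class N e) \<longleftrightarrow> (\<exists>k y. x = k * int K + y \<and> [y = e] (mod int N))" for x
    unfolding residue_proj_def set_add_defs int_Idl
    by (simp add: Bex_def residue_class_mem_iff) blast
  moreover have "(\<exists>k y. x = k * int K + y \<and> [y = e] (mod int N)) \<longleftrightarrow> [x = e] (mod int K)" for x
  proof
    assume "\<exists>k y. x = k * int K + y \<and> [y = e] (mod int N)"
    then obtain k y where "x = k * int K + y" "[y = e] (mod int K)"
      using assms cong_dvd_modulus by (metis of_nat_dvd_iff)
    then show "[x = e] (mod int K)"
      by (simp add: cong_def)
  next
    assume "[x = e] (mod int K)"
    then obtain k where "x = k * int K + e"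
      by (metis add.commute cong_iff_lin mult.commute cong_sym)
    then show "\<exists>k y. x = k * int K + y \<and> [y = e] (mod int N)"
      using cong_refl by blast
  qed
  ultimately show ?thesis
    by (auto simp: residue_class_mem_iff)
qed

section \<open>Moduli between \<open>s t\<close> and \<open>N\<close>\<close>

lemma square_part_mult_squarefree_part_dvd:
  fixes N :: nat
  shows "square_part N * squarefree_part N dvd N"
proof -
  have "square_part N * squarefree_part N dvd squarefree_part N * (square_part N)\<^sup>2"
    by (simp add: power2_eq_square)
  then show ?thesis by (simp flip: squarefree_decompose)
qed

text \<open>\<open>N\<close> divides the square of \<open>s t\<close>, so every prime factor of
  \<open>N\<close> already divides \<open>K\<close>.\<close>

lemma coprime_of_square_part_mult_squarefree_part:
  fixes N K :: nat
  assumes "square_part N * squarefree_part N dvd K" "coprime e (int K)"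
  shows "coprime e (int N)"
proof -
  have "N dvd (square_part N * squarefree_part N)\<^sup>2"
  proof -
    have "squarefree_part N * (square_part N)\<^sup>2 dvd (square_part N * squarefree_part N)\<^sup>2"
      by (simp add: power2_eq_square)
    then show ?thesis by (simp flip: squarefree_decompose)
  qed
  also have "\<dots> dvd K\<^sup>2" using assms(1) by (rule dvd_power_same)
  finally have "int N dvd (int K)\<^sup>2" by (metis of_nat_dvd_iff of_nat_power)
  moreover have "coprime e ((int K)\<^sup>2)" using assms(2) by simp
  ultimately show ?thesis using coprime_divisors dvd_refl by blast
qed

text \<open>The Chinese remainder theorem for moduli that need not be coprime, read off from a
  Bezout identity. It makes admissible moduli closed under gcd.\<close>

lemma cong_gcd_split:
  fixes e m n :: int
  assumes "[e = 1] (mod gcd m n)"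
  obtains x where "[x = 1] (mod m)" "[x = e] (mod n)"
proof -
  obtain k where k: "e = 1 + gcd m n * k"
    using assms by (metis cong_iff_lin cong_sym)
  obtain u v where uv: "u * m + v * n = gcd m n" using bezout_int by blast
  define x where "x = 1 + u * m * k"
  have "x - e = n * (- v * k)"
    unfolding x_def k uv[symmetric] by (simp add: algebra_simps)
  then have "[x = e] (mod n)" by (simp add: cong_iff_dvd_diff)
  moreover have "[x = 1] (mod m)" by (simp add: x_def cong_iff_dvd_diff)
  ultimately show ?thesis using that by blast
qed

subsection \<open>Subgroups of the unit group and their conductor\<close>

locale residue_subgroup =
  fixes N :: nat and H :: "int set set"
  assumes N_pos: "N > 0" and H_subgroup: "subgroup H (residue_units N)"
begin

definition reps :: "int set" where "reps = {e. residue_class N e \<in> H}"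

lemma reps_coprime: "e \<in> reps \<Longrightarrow> coprime e (int N)"
  using subgroup.subset[OF H_subgroup] residue_class_unit_iff unfolding reps_def by blast

lemma reps_cong: "e \<in> reps \<Longrightarrow> [e = h] (mod int N) \<Longrightarrow> h \<in> reps"
  using residue_class_eq_iff[of N e h] unfolding reps_def by simp

lemma reps_one: "1 \<in> reps"
  using subgroup.one_closed[OF H_subgroup] by (simp add: residue_units_one reps_def)

lemma reps_mult: "e \<in> reps \<Longrightarrow> h \<in> reps \<Longrightarrow> e * h \<in> reps"
  using subgroup.m_closed[OF H_subgroup, of "residue_class N e" "residue_class N h"]
  unfolding reps_def by (simp add: residue_class_mult)

lemma inverse_reps_iff:
  "inverse_reps N H e h \<longleftrightarrow> e \<in> reps \<and> h \<in> reps \<and> [e * h = 1] (mod int N)"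
  by (simp add: inverse_reps_def reps_def residue_class_mult residue_units_one residue_class_eq_iff)

text \<open>The condition minimized in \<open>K_H\<close>, with the kernel expressed through integer
  representatives instead of cosets.\<close>

definition admissible :: "nat \<Rightarrow> bool" where
  "admissible K \<longleftrightarrow> square_part N * squarefree_part N dvd K \<and> K dvd N \<and>
     (\<forall>e. coprime e (int N) \<longrightarrow> [e = 1] (mod int K) \<longrightarrow> e \<in> reps)"

lemma kernel_residue_proj_subset_iff:
  assumes "K dvd N"
  shows "kernel (residue_units N) (residue_units K) (residue_proj K) \<subseteq> H \<longleftrightarrow>
    (\<forall>e. coprime e (int N) \<longrightarrow> [e = 1] (mod int K) \<longrightarrow> e \<in> reps)"
proof -
  have "kernel (residue_units N) (residue_units K) (residue_proj K) =
      residue_class N ` {e. coprime e (int N) \<and> [e = 1] (mod int K)}"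
  proof -
    have "residue_proj K (residue_class N e) = residue_class K 1 \<longleftrightarrow> [e = 1] (mod int K)" for e
      by (simp add: residue_proj_class[OF assms] residue_class_eq_iff)
    then show ?thesis unfolding kernel_def residue_units_carrier residue_units_one by auto
  qed
  then show ?thesis by (auto simp: reps_def)
qed

lemma K_H_eq: "K_H N H = (LEAST K. admissible K)"
  unfolding K_H_def admissible_def by (simp only: kernel_residue_proj_subset_iff cong: conj_cong)

lemma admissible_K_H: "admissible (K_H N H)"
  unfolding K_H_eq
proof (rule LeastI)
  have "e \<in> reps" if "[e = 1] (mod int N)" for e
    using reps_cong[OF reps_one] that cong_sym by blast
  then show "admissible N"
    by (simp add: admissible_def square_part_mult_squarefree_part_dvd)
qed

text \<open>By the previous coprimality argument \<open>y\<close> is a unit modulo \<open>N\<close>,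
  so \<open>y\<close> times an inverse of \<open>x\<close> lies in the kernel of the projection and
  hence in \<open>H\<close>; multiplying by \<open>x\<close> returns to \<open>y\<close>.\<close>

lemma reps_cong_admissible:
  assumes "admissible K" "x \<in> reps" "[x = y] (mod int K)"
  shows "y \<in> reps"
proof -
  have K: "square_part N * squarefree_part N dvd K" "K dvd N"
    "\<And>e. coprime e (int N) \<Longrightarrow> [e = 1] (mod int K) \<Longrightarrow> e \<in> reps"
    using assms(1) unfolding admissible_def by auto
  have x: "coprime x (int N)" using assms(2) by (rule reps_coprime)
  moreover have "int K dvd int N" using K(2) by simp
  ultimately have "coprime x (int K)" by (meson coprime_divisors dvd_refl)
  then have "coprime y (int K)" using assms(3) cong_imp_coprime by blast
  then have y: "coprime y (int N)"
    by (rule coprime_of_square_part_mult_squarefree_part[OF K(1)])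
  obtain t where t: "[x * t = 1] (mod int N)" using x coprime_iff_invertible_int by blast
  then have t_cop: "coprime t (int N)" by (metis coprime_iff_invertible_int mult.commute)
  have "[x * t = 1] (mod int K)" using t K(2) cong_dvd_modulus of_nat_dvd_iff by blast
  then have "[y * t = 1] (mod int K)"
    using assms(3) by (meson cong_scalar_right cong_sym cong_trans)
  then have "y * t \<in> reps" using K(3) y t_cop by simp
  then have "x * (y * t) \<in> reps" using assms(2) reps_mult by blast
  moreover have "[x * (y * t) = y] (mod int N)"
    using cong_scalar_left[OF t, of y] by (simp add: mult_ac)
  ultimately show ?thesis using reps_cong by blast
qed

text \<open>\<open>K_H\<close> is minimal for the usual order; divisibility follows because the gcd
  with another admissible modulus is again admissible. Indeed, if \<open>e\<close> is 1 modulo the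
  gcd, some \<open>x\<close> is 1 modulo one modulus and \<open>e\<close> modulo the other, and
  membership in \<open>reps\<close> passes from 1 to \<open>x\<close> to \<open>e\<close>.\<close>

lemma K_H_dvd:
  assumes "admissible K"
  shows "K_H N H dvd K"
proof -
  let ?K = "K_H N H"
  have "e \<in> reps" if e: "[e = 1] (mod int (gcd ?K K))" for e
  proof -
    obtain x where "[x = 1] (mod int ?K)" "[x = e] (mod int K)"
      using cong_gcd_split[of e "int ?K" "int K"] e by auto
    then show ?thesis
      using reps_cong_admissible[OF admissible_K_H reps_one] reps_cong_admissible[OF assms] cong_sym
      by blast
  qed
  then have "admissible (gcd ?K K)"
    using assms admissible_K_H unfolding admissible_def by auto
  then have "?K \<le> gcd ?K K" unfolding K_H_eq by (rule Least_le)
  moreover have "?K > 0"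
    using admissible_K_H N_pos unfolding admissible_def by (auto intro: dvd_pos_nat)
  ultimately have "gcd ?K K = ?K" by (meson dvd_imp_le gcd_dvd1 le_antisym)
  then show ?thesis by (metis gcd_dvd2)
qed

text \<open>The gcd of \<open>y\<close> and \<open>N\<close> is admissible: by Bezout, an integer
  that is 1 modulo this gcd has the form \<open>1 + j * y\<close> modulo \<open>N\<close>.\<close>

lemma K_H_dvd_of_unipotents:
  fixes y :: int
  assumes st: "int (square_part N * squarefree_part N) dvd y"
    and reps: "\<And>j. 1 + j * y \<in> reps"
  shows "int (K_H N H) dvd y"
proof -
  define K where "K = nat (gcd y (int N))"
  have K: "int K = gcd y (int N)" by (simp add: K_def)
  have "int (square_part N * squarefree_part N) dvd int K"
    using st square_part_mult_squarefree_part_dvd[of N] unfolding K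
    by (metis gcd_greatest of_nat_dvd_iff)
  moreover have "int K dvd int N" unfolding K by simp
  moreover have "e \<in> reps" if "[e = 1] (mod int K)" for e
  proof -
    obtain k where k: "e = 1 + int K * k" using \<open>[e = 1] (mod int K)\<close>
      by (metis cong_iff_lin cong_sym)
    obtain u v where "u * y + v * int N = int K" unfolding K using bezout_int by blast
    then have "e = 1 + (k * u) * y + int N * (v * k)" unfolding k by (simp add: algebra_simps flip: \<open>_ = int K\<close>)
    then show ?thesis using reps_cong[OF reps[of "k * u"], of e] by (simp add: cong_def)
  qed
  ultimately have "admissible K" unfolding admissible_def by (simp only: of_nat_dvd_iff) blast
  then have "int (K_H N H) dvd int K" using K_H_dvd by (simp only: of_nat_dvd_iff)
  then show ?thesis unfolding K by simp
qed

section \<open>Differences of inverse representatives and the level \<open>sigma_H\<close>\<close>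

lemma inverse_reps_one_plus: "inverse_reps N H (1 + int N) 1"
  unfolding inverse_reps_iff
  using reps_one reps_cong[OF reps_one, of "1 + int N"] by (simp add: cong_def)

lemma eta_H_nonneg: "eta_H N H \<ge> 0"
  unfolding eta_H_def by simp

lemma sigma_H_dvd_diff:
  assumes "inverse_reps N H e h"
  shows "int (sigma_H N H) dvd e - h"
proof -
  have "int (sigma_H N H) dvd eta_H N H"
    unfolding sigma_H_def using eta_H_nonneg by (metis gcd_dvd2 int_dvd_int_iff int_nat_eq)
  also have "\<dots> dvd e - h" unfolding eta_H_def by (rule Gcd_dvd) (use assms in blast)
  finally show ?thesis .
qed

text \<open>The difference \<open>N\<close> occurs, so \<open>x\<close> has the form
  \<open>X / N\<close> with \<open>X\<close> an integer. Integrality of \<open>x * d\<close> becomes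
  divisibility of \<open>X * d\<close> by \<open>N\<close>, which passes to the Gcd of the infinite
  set of differences without a Bezout combination.\<close>

lemma of_int_mult_eta_H:
  fixes x :: real
  assumes "\<And>e h. inverse_reps N H e h \<Longrightarrow> x * of_int (e - h) \<in> \<int>"
  shows "x * of_int (eta_H N H) \<in> \<int>"
proof -
  let ?D = "{e - h | e h. inverse_reps N H e h}"
  have "x * of_int (int N) \<in> \<int>" using assms[OF inverse_reps_one_plus] by simp
  then obtain X where X: "x * of_int (int N) = of_int X" by (auto elim: Ints_cases)
  have "int N dvd X * d" if d: "d \<in> ?D" for d
  proof -
    have "x * of_int d \<in> \<int>" using d assms by blast
    then obtain y where y: "x * of_int d = of_int y" by (auto elim: Ints_cases)
    have "(of_int (X * d) :: real) = of_int (int N) * (x * of_int d)" by (simp flip: X)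
    then have "(of_int (X * d) :: real) = of_int (int N * y)" using y by simp
    then have "X * d = int N * y" unfolding of_int_eq_iff .
    then show ?thesis by simp
  qed
  then have "int N dvd Gcd ((*) X ` ?D)" by (auto intro: Gcd_greatest)
  then have "int N dvd X * eta_H N H" by (simp add: Gcd_mult eta_H_def)
  then obtain k where "X * eta_H N H = int N * k" ..
  then have "x * of_int (int N) * of_int (eta_H N H) = of_int (int N) * of_int k"
    unfolding X by (metis of_int_mult)
  then have "x * of_int (eta_H N H) = of_int k" using N_pos by simp
  then show ?thesis by simp
qed

text \<open>By Bezout, \<open>sigma_H\<close> is an integer combination of
  \<open>N div K_H N H\<close> and \<open>eta_H N H\<close>, so the two bounds on the denominator of
  \<open>x\<close> combine.\<close>

lemma of_nat_mult_sigma_H: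
  fixes x :: real
  assumes "\<And>e h. inverse_reps N H e h \<Longrightarrow> x * of_int (e - h) \<in> \<int>"
    and "x * of_nat (N div K_H N H) \<in> \<int>"
  shows "x * of_nat (sigma_H N H) \<in> \<int>"
proof -
  obtain u v where uv: "u * int (N div K_H N H) + v * eta_H N H = gcd (int (N div K_H N H)) (eta_H N H)"
    using bezout_int by blast
  have "int (sigma_H N H) = gcd (int (N div K_H N H)) (eta_H N H)"
    unfolding sigma_H_def using eta_H_nonneg by (metis gcd_int_int_eq int_nat_eq)
  then have "int (sigma_H N H) = u * int (N div K_H N H) + v * eta_H N H" using uv by simp
  then have "(of_int (int (sigma_H N H)) :: real) = of_int (u * int (N div K_H N H) + v * eta_H N H)"
    by (rule arg_cong)
  then have "x * of_nat (sigma_H N H) =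
      of_int u * (x * of_nat (N div K_H N H)) + of_int v * (x * of_int (eta_H N H))"
    by (simp add: algebra_simps)
  also have "\<dots> \<in> \<int>" using assms of_int_mult_eta_H by (intro Ints_add Ints_mult[of "of_int _"]) auto
  finally show ?thesis .
qed

section \<open>The group \<open>Gamma_H\<close> and conjugation of its elements\<close>

lemma mat2_in_Gamma_H_iff:
  "mat2 p q r s \<in> Gamma_H N H \<longleftrightarrow>
    (\<exists>a b c d. p = of_int a \<and> q = of_int b \<and> r = of_int (int N * c) \<and> s = of_int d \<and>
       a * d - b * (int N * c) = 1 \<and> a \<in> reps \<and> d \<in> reps)"
proof -
  have e: "mat2 p q r s $ 1 $ 1 = p" "mat2 p q r s $ 2 $ 2 = s" by (simp_all add: mat2_def)
  show ?thesis
  proof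
    assume "mat2 p q r s \<in> Gamma_H N H"
    then obtain a b c d where "p = of_int a \<and> q = of_int b \<and> r = of_int c \<and> s = of_int d"
        "a * d - b * c = 1" "int N dvd c" "a \<in> reps \<and> d \<in> reps"
      unfolding Gamma_H_def Gamma0_def reps_def by (auto simp: e mat2_eq_iff)
    moreover from this(3) obtain c' where "c = int N * c'" ..
    ultimately show "\<exists>a b c d. p = of_int a \<and> q = of_int b \<and> r = of_int (int N * c) \<and> s = of_int d \<and>
       a * d - b * (int N * c) = 1 \<and> a \<in> reps \<and> d \<in> reps" by blast
  next
    assume "\<exists>a b c d. p = of_int a \<and> q = of_int b \<and> r = of_int (int N * c) \<and> s = of_int d \<and>
       a * d - b * (int N * c) = 1 \<and> a \<in> reps \<and> d \<in> reps"
    then obtain a b c d where A: "p = of_int a" "q = of_int b" "r = of_int (int N * c)" "s = of_int d"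
        "a * d - b * (int N * c) = 1" "a \<in> reps" "d \<in> reps" by blast
    have "mat2 p q r s \<in> Gamma0 N"
      unfolding Gamma0_def mem_Collect_eq A(1-4)
      by (intro exI[of _ a] exI[of _ b] exI[of _ "int N * c"] exI[of _ d]) (use A(5) in simp)
    then show "mat2 p q r s \<in> Gamma_H N H"
      unfolding Gamma_H_def mem_Collect_eq e using A(1,4,6,7) by (auto simp: reps_def)
  qed
qed

lemma Gamma_H_subset: "Gamma_H N H \<subseteq> carrier SL2R"
proof
  fix A assume A: "A \<in> Gamma_H N H"
  obtain p q r s where "A = mat2 p q r s" by (rule mat2_exhaust)
  with A obtain a b c d where A: "A = mat2 (of_int a) (of_int b) (of_int (int N * c)) (of_int d)"
      and 1: "a * d - b * (int N * c) = 1"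
    by (auto simp: mat2_in_Gamma_H_iff)
  have "(of_int (a * d - b * (int N * c)) :: real) = 1" unfolding 1 by simp
  then show "A \<in> carrier SL2R" unfolding A mat2_in_SL2R_iff by simp
qed

text \<open>For determinant 1 the last factor is the inverse matrix, so this is one half of the
  normalizer condition. The other half is the same predicate at the inverse, which lets each
  argument be made once and used twice.\<close>

definition conj_into :: "real \<Rightarrow> real \<Rightarrow> real \<Rightarrow> real \<Rightarrow> bool" where
  "conj_into \<alpha> \<beta> \<gamma> \<delta> \<longleftrightarrow> (\<forall>e f g h. e \<in> reps \<longrightarrow> h \<in> reps \<longrightarrow> e * h - f * (int N * g) = 1 \<longrightarrow>
     mat2 \<alpha> \<beta> \<gamma> \<delta> ** mat2 (of_int e) (of_int f) (of_int (int N * g)) (of_int h) **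
       mat2 \<delta> (- \<beta>) (- \<gamma>) \<alpha> \<in> Gamma_H N H)"

lemma mem_normalizer_Gamma_H_iff:
  assumes "\<alpha> * \<delta> - \<beta> * \<gamma> = 1"
  shows "mat2 \<alpha> \<beta> \<gamma> \<delta> \<in> normalizer SL2R (Gamma_H N H) \<longleftrightarrow>
    conj_into \<alpha> \<beta> \<gamma> \<delta> \<and> conj_into \<delta> (- \<beta>) (- \<gamma>) \<alpha>"
proof -
  have all: "(\<forall>M\<in>Gamma_H N H. P M) \<longleftrightarrow>
      (\<forall>e f g h. e \<in> reps \<longrightarrow> h \<in> reps \<longrightarrow> e * h - f * (int N * g) = 1 \<longrightarrow>
        P (mat2 (of_int e) (of_int f) (of_int (int N * g)) (of_int h)))" for P
  proof (intro iffI ballI allI impI)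
    fix M assume P: "\<forall>e f g h. e \<in> reps \<longrightarrow> h \<in> reps \<longrightarrow> e * h - f * (int N * g) = 1 \<longrightarrow>
        P (mat2 (of_int e) (of_int f) (of_int (int N * g)) (of_int h))"
      and M: "M \<in> Gamma_H N H"
    obtain p q r s where "M = mat2 p q r s" by (rule mat2_exhaust)
    with M P show "P M" by (auto simp: mat2_in_Gamma_H_iff)
  next
    fix e f g h
    assume P: "\<forall>M\<in>Gamma_H N H. P M"
      and "e \<in> reps" "h \<in> reps" "e * h - f * (int N * g) = 1"
    then have "mat2 (of_int e) (of_int f) (of_int (int N * g)) (of_int h) \<in> Gamma_H N H"
      unfolding mat2_in_Gamma_H_iff by blast
    then show "P (mat2 (of_int e) (of_int f) (of_int (int N * g)) (of_int h))" using P by blast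
  qed
  have "mat2 \<alpha> \<beta> \<gamma> \<delta> \<in> carrier SL2R" "inv\<^bsub>SL2R\<^esub> (mat2 \<alpha> \<beta> \<gamma> \<delta>) = mat2 \<delta> (- \<beta>) (- \<gamma>) \<alpha>"
    using assms by (simp_all add: mat2_in_SL2R_iff mat2_inv)
  then show ?thesis
    unfolding group.mem_normalizer_iff[OF group_SL2R Gamma_H_subset] conj_into_def
    unfolding ball_conj_distrib all by (simp add: SL2R_def)
qed

end

subsection \<open>Denominators and exact divisors\<close>

lemma rat_eq_quotient: "x = of_int (fst (quotient_of x)) / of_int (rat_denom x)"
  using quotient_of_div[of x "fst (quotient_of x)" "snd (quotient_of x)"] by (simp add: rat_denom_def)

lemma rat_denom_pos: "rat_denom x > 0"
  unfolding rat_denom_def by (rule quotient_of_denom_pos')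

lemma coprime_num_denom: "coprime (fst (quotient_of x)) (rat_denom x)"
  unfolding rat_denom_def by (rule quotient_of_coprime) simp

lemma in_frac_iff: "in_frac s x \<longleftrightarrow> rat_denom x dvd int s"
proof -
  let ?n = "fst (quotient_of x)" and ?d = "rat_denom x"
  have d: "(of_int ?d :: rat) \<noteq> 0" using rat_denom_pos[of x] by simp
  have "in_frac s x \<longleftrightarrow> (\<exists>k. of_nat s * (of_int ?n / of_int ?d) = (of_int k :: rat))"
    unfolding in_frac_def using rat_eq_quotient[of x] by (auto elim!: Ints_cases)
  also have "\<dots> \<longleftrightarrow> (\<exists>k. (of_int (int s * ?n) :: rat) = of_int (?d * k))"
    using d by (simp add: field_simps)
  also have "\<dots> \<longleftrightarrow> ?d dvd int s * ?n" unfolding of_int_eq_iff by (auto simp: dvd_def)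
  also have "\<dots> \<longleftrightarrow> ?d dvd int s"
    using coprime_num_denom[of x] by (simp add: coprime_commute coprime_dvd_mult_left_iff)
  finally show ?thesis .
qed

lemma no_cancelationI:
  assumes "coprime (fst (quotient_of x)) (rat_denom y)" "coprime (fst (quotient_of y)) (rat_denom x)"
  shows "no_cancelation x y"
proof -
  let ?nx = "fst (quotient_of x)" and ?ny = "fst (quotient_of y)"
  have "coprime (?nx * ?ny) (rat_denom x * rat_denom y)"
    using assms coprime_num_denom[of x] coprime_num_denom[of y] by simp
  moreover have "rat_denom x * rat_denom y > 0" using rat_denom_pos by simp
  ultimately have "Rat.normalize (?nx * ?ny, rat_denom x * rat_denom y) = (?nx * ?ny, rat_denom x * rat_denom y)"
    by (intro normalize_stable) auto
  then show ?thesis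
    unfolding no_cancelation_def
    by (simp add: rat_denom_def rat_times_code case_prod_beta Let_def)
qed

text \<open>In lowest terms \<open>x = n / d\<close> the hypothesis reads
  \<open>n^2 * m = p * d^2\<close>, and \<open>n^2\<close> and \<open>d^2\<close> are
  coprime.\<close>

lemma rat_square_mult:
  fixes x :: rat
  assumes "x\<^sup>2 * of_int m = of_int p"
  shows "(fst (quotient_of x))\<^sup>2 dvd p" "(rat_denom x)\<^sup>2 dvd m"
proof -
  let ?n = "fst (quotient_of x)" and ?d = "rat_denom x"
  have d: "(of_int ?d :: rat) \<noteq> 0" using rat_denom_pos[of x] by simp
  have "(of_int ?n / of_int ?d)\<^sup>2 * of_int m = (of_int p :: rat)"
    using assms rat_eq_quotient[of x] by simp
  then have "(of_int (?n\<^sup>2 * m) :: rat) = of_int (p * ?d\<^sup>2)"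
    using d by (simp add: field_simps)
  then have eq: "?n\<^sup>2 * m = p * ?d\<^sup>2" unfolding of_int_eq_iff .
  have cop: "coprime (?n\<^sup>2) (?d\<^sup>2)" using coprime_num_denom[of x] by simp
  have "?n\<^sup>2 dvd p * ?d\<^sup>2" using eq by (metis dvd_triv_left)
  then show "?n\<^sup>2 dvd p" using cop coprime_dvd_mult_left_iff by blast
  have "?d\<^sup>2 dvd ?n\<^sup>2 * m" using eq by simp
  then show "?d\<^sup>2 dvd m" using cop coprime_dvd_mult_right_iff coprime_commute by blast
qed

text \<open>The square of the denominator divides \<open>m\<close>, and the square part of
  \<open>m\<close> is a multiple of every integer whose square divides \<open>m\<close>. This
  produces the denominator conditions of a presentation.\<close>

lemma in_frac_square_partI:
  assumes "x\<^sup>2 * of_nat m = of_int p"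
  shows "in_frac (square_part m) x"
proof -
  have "(rat_denom x)\<^sup>2 dvd int m" using rat_square_mult(2)[of x "int m" p] assms by simp
  then have "(nat (rat_denom x))\<^sup>2 dvd m"
    using rat_denom_pos[of x] by (simp add: nat_power_eq[symmetric] nat_dvd_iff)
  then have "nat (rat_denom x) dvd square_part m" by (simp add: dvd_square_part_iff)
  then show ?thesis using rat_denom_pos[of x] by (simp add: in_frac_iff nat_dvd_iff)
qed

lemma in_frac_square_part_mult:
  assumes "in_frac (square_part m) x" "in_frac (square_part m) y"
  shows "x * y * of_nat m \<in> \<int>"
proof -
  have m: "m = squarefree_part m * (square_part m)\<^sup>2" by (rule squarefree_decompose)
  have "x * y * of_nat m = of_nat (squarefree_part m) * (of_nat (square_part m) * x) *
      (of_nat (square_part m) * y)"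
    by (subst m) (simp add: power2_eq_square mult_ac del: squarefree_decompose)
  also have "\<dots> \<in> \<int>" using assms unfolding in_frac_def by (intro Ints_mult[OF Ints_mult[OF Ints_of_nat]])
  finally show ?thesis .
qed

lemma in_frac_imp_denom_dvd:
  assumes "in_frac (square_part m) x"
  shows "rat_denom x dvd int m"
proof -
  have "square_part m dvd m"
    using square_part_square_dvd[of m] dvd_mult_left by (auto simp: power2_eq_square)
  then show ?thesis using assms unfolding in_frac_iff by (meson dvd_trans of_nat_dvd_iff)
qed

text \<open>The square of \<open>y / N\<close> times \<open>N\<close> is the integer
  \<open>k\<close>, so \<open>s * y / N\<close> is an integer; since \<open>N = s * (s * t)\<close>,
  this says that \<open>s * t\<close> divides \<open>y\<close>.\<close>

lemma square_part_mult_squarefree_part_dvd_of_square: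
  assumes "N > 0" "y\<^sup>2 = int N * k"
  shows "int (square_part N * squarefree_part N) dvd y"
proof -
  let ?s = "square_part N" and ?t = "squarefree_part N"
  have N: "(of_nat N :: rat) \<noteq> 0" using assms(1) by simp
  have st: "(of_nat N :: rat) = of_nat ?s * of_nat (?s * ?t)"
    using arg_cong[OF squarefree_decompose[of N], of "of_nat :: nat \<Rightarrow> rat"]
    by (simp add: power2_eq_square mult_ac)
  have "(of_int y)\<^sup>2 = (of_nat N * of_int k :: rat)"
    using assms(2) by (metis of_int_mult of_int_of_nat_eq of_int_power)
  then have "(of_int y / of_nat N)\<^sup>2 * of_nat N = (of_int k :: rat)"
    using N by (simp add: power_divide power2_eq_square[of "of_nat N"])
  then have "in_frac ?s (of_int y / of_nat N)" by (rule in_frac_square_partI)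
  then obtain z where "of_nat ?s * (of_int y / of_nat N) = (of_int z :: rat)"
    unfolding in_frac_def by (rule Ints_cases)
  then have "(of_int y :: rat) = of_int (int (?s * ?t) * z)"
    using N unfolding st by (simp add: field_simps)
  then have "y = int (?s * ?t) * z" unfolding of_int_eq_iff .
  then show ?thesis by simp
qed

section \<open>Coprime factors of squares and the choice of an exact divisor\<close>

lemma coprime_mult_eq_square:
  fixes x y k :: nat
  assumes "coprime x y" "x * y = k\<^sup>2"
  obtains a b where "x = a\<^sup>2" "y = b\<^sup>2"
proof -
  have "is_nth_power 2 (x * y)" using assms(2) by (auto intro: is_nth_powerI)
  then have "is_nth_power 2 x \<and> is_nth_power 2 y"
    using is_nth_power_mult_coprime_nat_iff[OF assms(1)] by simp
  then show thesis using that by (auto elim!: is_nth_powerE)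
qed

text \<open>Here \<open>\<mu>\<close> is the part of \<open>N\<close> supported at the primes dividing \<open>u\<close>.\<close>

lemma gcd_power_exact_divisor:
  fixes u :: int
  assumes N: "N > 0" and \<mu>: "int \<mu> = gcd (int N) (u ^ N)"
  shows "exact_divisor \<mu> N" "coprime (int (N div \<mu>)) u" "coprime (int \<mu>) (u - 1)"
proof -
  have "int \<mu> dvd int N" unfolding \<mu> by simp
  then have dvd: "\<mu> dvd N" by (simp only: of_nat_dvd_iff)
  show cop: "coprime (int (N div \<mu>)) u"
  proof (rule ccontr)
    let ?g = "gcd (int (N div \<mu>)) u"
    assume "\<not> coprime (int (N div \<mu>)) u"
    then have "\<not> is_unit ?g" by (simp add: coprime_iff_gcd_eq_1)
    moreover have "?g \<noteq> 0" using N dvd by (auto elim: dvdE)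
    ultimately obtain l where "Factorial_Ring.prime l" "l dvd ?g" by (metis prime_divisorE)
    then have l: "Factorial_Ring.prime l" "l dvd int (N div \<mu>)" "l dvd u" by auto
    define k where "k = multiplicity l (int N)"
    have lk: "l ^ k dvd int N" unfolding k_def by (rule multiplicity_dvd)
    \<comment> \<open>The exponent \<open>N\<close> in \<open>u ^ N\<close> is large enough: the
      multiplicity \<open>k\<close> of \<open>l\<close> in \<open>N\<close> is at most
      \<open>N\<close>. Hence \<mu> absorbs the full power of \<open>l\<close>, and one more factor
      \<open>l\<close> in \<open>N div \<mu>\<close> is impossible.\<close>
    have "2 ^ k \<le> l ^ k" using prime_ge_2_int[OF l(1)] by (intro power_mono) auto
    also have "\<dots> \<le> int N" using lk N by (intro zdvd_imp_le) auto
    finally have "2 ^ k \<le> N" by (simp flip: of_nat_le_iff)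
    then have "k \<le> N" using less_exp[of k] by linarith
    then have "l ^ k dvd u ^ N" using l(3) by (meson dvd_power_same dvd_trans le_imp_power_dvd)
    then have "l ^ k dvd int \<mu>" unfolding \<mu> using lk by simp
    then have "l ^ k * l dvd int \<mu> * int (N div \<mu>)" using l(2) by (rule mult_dvd_mono)
    also have "int \<mu> * int (N div \<mu>) = int N" using dvd by (metis dvd_mult_div_cancel of_nat_mult)
    finally have "l ^ Suc k dvd int N" by (simp add: mult.commute)
    moreover have "\<not> is_unit l" using l(1) not_prime_unit by blast
    ultimately have "Suc k \<le> k" unfolding k_def using N by (intro multiplicity_geI) auto
    then show False by simp
  qed
  have "int \<mu> dvd u ^ N" unfolding \<mu> by simp
  moreover have "coprime (u ^ N) (int (N div \<mu>))" "coprime (u ^ N) (u - 1)"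
    using cop coprime_commute[of u "int (N div \<mu>)"] by simp_all
  ultimately have "coprime (int \<mu>) (int (N div \<mu>))" "coprime (int \<mu>) (u - 1)"
    by (meson coprime_divisors dvd_refl)+
  then show "exact_divisor \<mu> N" "coprime (int \<mu>) (u - 1)"
    using dvd by (simp_all add: exact_divisor_def)
qed

lemma of_rat_of_square_eq:
  fixes x :: real
  assumes "x\<^sup>2 = (of_nat k / of_nat m)\<^sup>2"
  obtains y where "x = of_rat y"
proof -
  have "x = of_rat (of_nat k / of_nat m) \<or> x = of_rat (- (of_nat k / of_nat m))"
    using assms by (auto simp: power2_eq_iff of_rat_divide of_rat_minus)
  then show thesis using that by blast
qed

subsection \<open>Elements with a cancelation-free presentation\<close>

lemma Ints_square_Nats:
  fixes x :: real
  assumes "x\<^sup>2 * of_nat k \<in> \<int>"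
  obtains p :: nat where "x\<^sup>2 * of_nat k = of_nat p"
proof -
  have "x\<^sup>2 * of_nat k \<in> \<nat>" using assms by (simp add: Nats_altdef2)
  then show thesis using that by (auto elim: Nats_cases)
qed

text \<open>Presentation-free constraints on the entries of an element of \<open>\<Gamma>\<^sub>0\<^sup>*\<^sup>,\<^sup>\<sigma>(N)\<close>, stable under
  \<open>(\<alpha>, \<beta>, \<gamma>, \<delta>) \<mapsto> (\<delta>, -\<beta>, -\<gamma>, \<alpha>)\<close>, that is, under inversion.\<close>

definition star_entries :: "nat \<Rightarrow> nat \<Rightarrow> real \<Rightarrow> real \<Rightarrow> real \<Rightarrow> real \<Rightarrow> bool" where
  "star_entries N \<sigma> \<alpha> \<beta> \<gamma> \<delta> \<longleftrightarrow> \<alpha> * \<delta> - \<beta> * \<gamma> = 1 \<and> \<alpha>\<^sup>2 \<in> \<int> \<and> \<delta>\<^sup>2 \<in> \<int> \<and>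
     \<beta>\<^sup>2 * of_nat N \<in> \<int> \<and> \<gamma>\<^sup>2 / of_nat N \<in> \<int> \<and> \<alpha> * \<delta> \<in> \<int> \<and>
     \<alpha> * \<beta> * of_nat \<sigma> \<in> \<int> \<and> \<gamma> * \<delta> / of_nat N * of_nat \<sigma> \<in> \<int> \<and>
     \<alpha> * \<gamma> / of_nat N * of_nat \<sigma> \<in> \<int> \<and> \<beta> * \<delta> * of_nat \<sigma> \<in> \<int>"

lemma star_entries_inv: "star_entries N \<sigma> \<alpha> \<beta> \<gamma> \<delta> \<Longrightarrow> star_entries N \<sigma> \<delta> (- \<beta>) (- \<gamma>) \<alpha>"
  unfolding star_entries_def by (auto simp: mult.commute)

lemma of_rat_Ints: "x \<in> \<int> \<Longrightarrow> (of_rat x :: real) \<in> \<int>"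
  by (auto elim!: Ints_cases)

text \<open>The denominators of \<open>a\<close>, \<open>d\<close> divide \<mu> and those of
  \<open>b\<close>, \<open>c\<close> divide \<open>N div \<mu>\<close>, so they are coprime. Without
  cancelation the denominator of a mixed product is a product of two coprime divisors of \<sigma>,
  hence divides \<sigma>. In all the quantities concerned the square roots of \<mu> cancel or
  combine to \<mu>.\<close>

lemma Gamma0_star_imp_star_entries:
  assumes N: "N > 0" and A: "mat2 \<alpha> \<beta> \<gamma> \<delta> \<in> Gamma0_star N \<sigma>"
  shows "star_entries N \<sigma> \<alpha> \<beta> \<gamma> \<delta>"
proof -
  have det: "\<alpha> * \<delta> - \<beta> * \<gamma> = 1"
    using A unfolding Gamma0_star_def Gamma0_star_full_def by (simp add: mat2_in_SL2R_iff)
  obtain \<mu> a b c d where pres: "is_presentation N (mat2 \<alpha> \<beta> \<gamma> \<delta>) \<mu> a b c d"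
    and free: "cancelation_free a b c d"
    and frac: "in_frac \<sigma> a" "in_frac \<sigma> b" "in_frac \<sigma> c" "in_frac \<sigma> d"
    using A unfolding Gamma0_star_def by blast
  define M where "M = N div \<mu>"
  have ex: "exact_divisor \<mu> N"
    and fr: "in_frac (square_part \<mu>) a" "in_frac (square_part \<mu>) d"
      "in_frac (square_part M) b" "in_frac (square_part M) c"
    and ent: "\<alpha> = of_rat a * sqrt (real \<mu>)" "\<beta> = of_rat b / sqrt (real \<mu>)"
      "\<gamma> = of_rat c * real M * sqrt (real \<mu>)" "\<delta> = of_rat d * sqrt (real \<mu>)"
    using pres unfolding is_presentation_def M_def by (auto simp: mat2_eq_iff)
  have NM: "N = \<mu> * M" using ex by (simp add: exact_divisor_def M_def)
  have pos: "\<mu> > 0" "M > 0" using N NM by auto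
  have sq: "sqrt (real \<mu>) * sqrt (real \<mu>) = real \<mu>" by simp
  have nz: "real \<mu> \<noteq> 0" "sqrt (real \<mu>) \<noteq> 0" "real M \<noteq> 0" using pos by auto
  have cop: "coprime (int \<mu>) (int M)" using ex by (simp add: exact_divisor_def M_def)
  have prod: "x * y * of_nat \<sigma> \<in> \<int>"
    if "no_cancelation x y" "in_frac \<sigma> x" "in_frac \<sigma> y"
      "coprime (rat_denom x) (rat_denom y)" for x y
  proof -
    have "rat_denom (x * y) dvd int \<sigma>"
      using that unfolding no_cancelation_def in_frac_iff by (simp add: divides_mult)
    then have "in_frac \<sigma> (x * y)" by (simp add: in_frac_iff)
    then show ?thesis by (simp add: in_frac_def mult.commute)
  qed
  have den: "rat_denom a dvd int \<mu>" "rat_denom d dvd int \<mu>" "rat_denom b dvd int M"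
      "rat_denom c dvd int M"
    using fr in_frac_imp_denom_dvd by blast+
  have "a * b * of_nat \<sigma> \<in> \<int>" "a * c * of_nat \<sigma> \<in> \<int>" "b * d * of_nat \<sigma> \<in> \<int>" "c * d * of_nat \<sigma> \<in> \<int>"
    using free frac coprime_divisors[OF den(1) den(3) cop] coprime_divisors[OF den(1) den(4) cop]
      coprime_divisors[OF den(2) den(3) cop] coprime_divisors[OF den(2) den(4) cop]
    unfolding cancelation_free_def
    by (metis coprime_commute prod)+
  moreover have "a * a * of_nat \<mu> \<in> \<int>" "d * d * of_nat \<mu> \<in> \<int>" "a * d * of_nat \<mu> \<in> \<int>"
      "b * b * of_nat M \<in> \<int>" "c * c * of_nat M \<in> \<int>"
    using fr by (auto intro: in_frac_square_part_mult)
  ultimately have int: "a * b * of_nat \<sigma> \<in> \<int>" "a * c * of_nat \<sigma> \<in> \<int>"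
      "b * d * of_nat \<sigma> \<in> \<int>" "c * d * of_nat \<sigma> \<in> \<int>"
      "a * a * of_nat \<mu> \<in> \<int>" "d * d * of_nat \<mu> \<in> \<int>" "a * d * of_nat \<mu> \<in> \<int>"
      "b * b * of_nat M \<in> \<int>" "c * c * of_nat M \<in> \<int>"
    by blast+
  have "\<alpha>\<^sup>2 = of_rat (a * a * of_nat \<mu>)" "\<delta>\<^sup>2 = of_rat (d * d * of_nat \<mu>)"
      "\<alpha> * \<delta> = of_rat (a * d * of_nat \<mu>)"
    by (simp_all add: ent of_rat_mult power_mult_distrib power2_eq_square[of "of_rat _"])
  moreover have "\<beta>\<^sup>2 * of_nat N = of_rat (b * b * of_nat M)"
      "\<gamma>\<^sup>2 / of_nat N = of_rat (c * c * of_nat M)"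
    using nz by (simp_all add: ent NM of_rat_mult power_mult_distrib power_divide
      power2_eq_square[of "of_rat _"] power2_eq_square[of "real M"])
  moreover have "\<alpha> * \<beta> * of_nat \<sigma> = of_rat (a * b * of_nat \<sigma>)"
      "\<beta> * \<delta> * of_nat \<sigma> = of_rat (b * d * of_nat \<sigma>)"
    using nz by (simp_all add: ent of_rat_mult)
  moreover have "\<gamma> * \<delta> / of_nat N * of_nat \<sigma> = of_rat (c * d * of_nat \<sigma>)"
      "\<alpha> * \<gamma> / of_nat N * of_nat \<sigma> = of_rat (a * c * of_nat \<sigma>)"
    using nz sq by (simp_all add: ent NM of_rat_mult field_simps)
  ultimately show ?thesis unfolding star_entries_def using int[THEN of_rat_Ints] det by simp
qed

text \<open>Only \<alpha>\<beta> and \<gamma>\<delta> are tested against \<sigma>: in a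
  cancelation-free presentation a bound on the denominator of \<open>a * b\<close> or
  \<open>c * d\<close> bounds the denominators of both factors.\<close>

lemma Gamma0_starI:
  assumes N: "N > 0" and det: "\<alpha> * \<delta> - \<beta> * \<gamma> = 1"
    and int: "\<alpha>\<^sup>2 \<in> \<int>" "\<delta>\<^sup>2 \<in> \<int>" "\<beta>\<^sup>2 * of_nat N \<in> \<int>" "\<gamma>\<^sup>2 / of_nat N \<in> \<int>"
      "\<alpha> * \<delta> \<in> \<int>" "\<alpha> * \<gamma> \<in> \<int>" "\<beta> * \<delta> * of_nat N \<in> \<int>"
    and \<sigma>: "\<alpha> * \<beta> * of_nat \<sigma> \<in> \<int>" "\<gamma> * \<delta> / of_nat N * of_nat \<sigma> \<in> \<int>"
  shows "mat2 \<alpha> \<beta> \<gamma> \<delta> \<in> Gamma0_star N \<sigma>"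
proof -
  have N0: "real N \<noteq> 0" using N by simp
  obtain p where p: "\<alpha>\<^sup>2 = real p" using Ints_square_Nats[of \<alpha> 1] int(1) by auto
  obtain q where q: "\<delta>\<^sup>2 = real q" using Ints_square_Nats[of \<delta> 1] int(2) by auto
  obtain r where r: "\<beta>\<^sup>2 * real N = real r" using Ints_square_Nats[of \<beta> N] int(3) by auto
  have "(\<gamma> / real N)\<^sup>2 * real N = \<gamma>\<^sup>2 / real N" using N0 by (simp add: power2_eq_square)
  then obtain w where w: "\<gamma>\<^sup>2 / real N = real w"
    using Ints_square_Nats[of "\<gamma> / real N" N] int(4) by metis
  have w': "\<gamma>\<^sup>2 = real w * real N" using w N0 by (simp add: field_simps)
  obtain u where u: "\<alpha> * \<delta> = of_int u" using int(5) by (auto elim: Ints_cases)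
  have v: "\<beta> * \<gamma> = of_int (u - 1)" using det u by simp
  obtain y where y: "\<alpha> * \<gamma> = of_int y" using int(6) by (auto elim: Ints_cases)
  obtain z where z: "\<beta> * \<delta> * of_nat N = of_int z" using int(7) by (auto elim: Ints_cases)

  text \<open>Putting the primes dividing \<open>\<alpha>\<delta>\<close> into \<open>\<mu>\<close>, and hence those dividing \<open>\<beta>\<gamma> = \<alpha>\<delta> - 1\<close> into \<open>M\<close>, is what
    makes the resulting presentation cancelation-free.\<close>
  define \<mu> where "\<mu> = nat (gcd (int N) (u ^ N))"
  define M where "M = N div \<mu>"
  have "int \<mu> = gcd (int N) (u ^ N)" by (simp add: \<mu>_def)
  note \<mu> = gcd_power_exact_divisor[OF N this, folded M_def]
  have NM: "N = \<mu> * M" using \<mu>(1) by (simp add: exact_divisor_def M_def)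
  have pos: "\<mu> > 0" "M > 0" using N NM by auto
  have nz: "real \<mu> \<noteq> 0" "sqrt (real \<mu>) \<noteq> 0" "real M \<noteq> 0" using pos by auto
  have cop: "coprime (int \<mu>) (int M)" using \<mu>(1) by (simp add: exact_divisor_def M_def)

  \<comment> \<open>Squaring \<alpha>\<delta>, \<beta>\<gamma>, \<alpha>\<gamma> and
    \<beta>\<delta>N gives integer identities. The first two confine the primes of \<open>p\<close>,
    \<open>q\<close> to those of \<open>u\<close> and the primes of \<open>r\<close>,
    \<open>w\<close> to those of \<open>u - 1\<close>; the last two are the perfect squares to be
    split.\<close>
  have "(of_int (int (p * q)) :: real) = of_int (u\<^sup>2)"
    using p q u by (metis of_int_of_nat_eq of_int_power of_nat_mult power_mult_distrib)
  then have pq: "int (p * q) = u\<^sup>2" unfolding of_int_eq_iff .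
  have "(of_int (int (r * w)) :: real) = (\<beta> * \<gamma>)\<^sup>2"
    using r w' N0 by (simp add: power_mult_distrib flip: r)
  then have "(of_int (int (r * w)) :: real) = of_int ((u - 1)\<^sup>2)" unfolding v by simp
  then have rw: "int (r * w) = (u - 1)\<^sup>2" unfolding of_int_eq_iff .
  have "(of_int (int (p * w * N)) :: real) = (\<alpha> * \<gamma>)\<^sup>2"
    using p w' by (simp add: power_mult_distrib)
  then have "(of_int (int (p * w * N)) :: real) = of_int (y\<^sup>2)" unfolding y by simp
  then have pw: "int (p * w * N) = y\<^sup>2" unfolding of_int_eq_iff .
  have "(of_int (int (q * r * N)) :: real) = (\<beta> * \<delta> * of_nat N)\<^sup>2"
    using q by (simp add: power_mult_distrib power2_eq_square[of "real N"] flip: r)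
  then have "(of_int (int (q * r * N)) :: real) = of_int (z\<^sup>2)" unfolding z by simp
  then have qr: "int (q * r * N) = z\<^sup>2" unfolding of_int_eq_iff .

  have dvd: "int p dvd u\<^sup>2" "int q dvd u\<^sup>2" "int r dvd (u - 1)\<^sup>2" "int w dvd (u - 1)\<^sup>2"
    using pq rw by (metis dvd_triv_left dvd_triv_right of_nat_mult)+
  have uu: "coprime (u\<^sup>2) ((u - 1)\<^sup>2)" "coprime (u\<^sup>2) (int M)" "coprime (int \<mu>) ((u - 1)\<^sup>2)"
  proof -
    have "coprime u (u - 1)" by simp
    then show "coprime (u\<^sup>2) ((u - 1)\<^sup>2)" by (simp only: coprime_power_left_iff coprime_power_right_iff) simp
    show "coprime (u\<^sup>2) (int M)" "coprime (int \<mu>) ((u - 1)\<^sup>2)"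
      using \<mu>(2,3) coprime_commute[of u "int M"] by simp_all
  qed
  note cops = coprime_divisors[OF dvd(1) dvd(4) uu(1)] coprime_divisors[OF dvd(2) dvd(3) uu(1)]
    coprime_divisors[OF dvd(1) dvd_refl uu(2)] coprime_divisors[OF dvd(2) dvd_refl uu(2)]
    coprime_divisors[OF dvd_refl dvd(4) uu(3)] coprime_divisors[OF dvd_refl dvd(3) uu(3)] cop
  have c: "coprime (p * \<mu>) (w * M)" "coprime (q * \<mu>) (r * M)"
    using cops by (simp_all only: coprime_int_iff coprime_mult_left_iff coprime_mult_right_iff simp_thms)
  have "int (p * \<mu> * (w * M)) = int ((nat \<bar>y\<bar>)\<^sup>2)" "int (q * \<mu> * (r * M)) = int ((nat \<bar>z\<bar>)\<^sup>2)"
    using pw qr by (simp_all add: NM mult_ac)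
  then have e: "p * \<mu> * (w * M) = (nat \<bar>y\<bar>)\<^sup>2" "q * \<mu> * (r * M) = (nat \<bar>z\<bar>)\<^sup>2"
    by (simp_all only: of_nat_eq_iff)
  obtain k1 k2 where k1: "p * \<mu> = k1\<^sup>2" and k2: "w * M = k2\<^sup>2"
    using coprime_mult_eq_square[OF c(1) e(1)] by blast
  obtain k3 k4 where k3: "q * \<mu> = k3\<^sup>2" and k4: "r * M = k4\<^sup>2"
    using coprime_mult_eq_square[OF c(2) e(2)] by blast

  text \<open>Each of the products \<open>p\<mu> \<cdot> wM = (\<alpha>\<gamma>)\<^sup>2\<close> and \<open>q\<mu> \<cdot> rM = (\<beta>\<delta>N)\<^sup>2\<close> has coprime factors, so the factors
    are squares and \<open>a, b, c, d\<close> are rational.\<close>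
  have quot: "real x / real m = (real k / real m)\<^sup>2" if "x * m = k\<^sup>2" "m > 0" for x m k :: nat
  proof -
    have "real x * real m = (real k)\<^sup>2" using that(1) by (metis of_nat_mult of_nat_power)
    then show ?thesis using that(2) by (simp add: power_divide field_simps power2_eq_square)
  qed
  have a2: "(\<alpha> / sqrt (real \<mu>))\<^sup>2 = real p / real \<mu>" by (simp add: power_divide p)
  then obtain a where a: "\<alpha> / sqrt (real \<mu>) = of_rat a"
    using of_rat_of_square_eq quot[OF k1 pos(1)] by metis
  have d2: "(\<delta> / sqrt (real \<mu>))\<^sup>2 = real q / real \<mu>" by (simp add: power_divide q)
  then obtain d where d: "\<delta> / sqrt (real \<mu>) = of_rat d"
    using of_rat_of_square_eq quot[OF k3 pos(1)] by metis
  have b2: "(\<beta> * sqrt (real \<mu>))\<^sup>2 = real r / real M"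
    using nz by (simp add: power_mult_distrib NM flip: r)
  then obtain b where b: "\<beta> * sqrt (real \<mu>) = of_rat b"
    using of_rat_of_square_eq quot[OF k4 pos(2)] by metis
  have c2: "(\<gamma> / (real M * sqrt (real \<mu>)))\<^sup>2 = real w / real M"
    using nz by (simp add: power_divide power_mult_distrib w' NM power2_eq_square[of "real M"])
  then obtain c where c: "\<gamma> / (real M * sqrt (real \<mu>)) = of_rat c"
    using of_rat_of_square_eq quot[OF k2 pos(2)] by metis

  have to_rat: "x\<^sup>2 * of_nat m = of_int (int k)" if "(of_rat x)\<^sup>2 * real m = real k" for x m k
  proof -
    have "of_rat (x\<^sup>2 * of_nat m) = (of_rat (of_nat k) :: real)"
      using that by (simp add: of_rat_mult of_rat_power)
    then have "x\<^sup>2 * of_nat m = of_nat k" unfolding of_rat_eq_iff .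
    then show ?thesis by simp
  qed
  have sqs: "a\<^sup>2 * of_nat \<mu> = of_int (int p)" "d\<^sup>2 * of_nat \<mu> = of_int (int q)"
      "b\<^sup>2 * of_nat M = of_int (int r)" "c\<^sup>2 * of_nat M = of_int (int w)"
    by (rule to_rat, unfold a[symmetric] b[symmetric] c[symmetric] d[symmetric] a2 b2 c2 d2,
        use nz in simp)+
  have pres: "is_presentation N (mat2 \<alpha> \<beta> \<gamma> \<delta>) \<mu> a b c d"
    unfolding is_presentation_def M_def[symmetric]
    using \<mu>(1) sqs[THEN in_frac_square_partI] nz by (simp add: mat2_eq_iff flip: a b c d)

  have num: "(fst (quotient_of x))\<^sup>2 dvd int k" "rat_denom x dvd int m"
    if "x\<^sup>2 * of_nat m = of_int (int k)" for x m k
    using that rat_square_mult[of x "int m" "int k"]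
    by (auto simp: power2_eq_square dest: dvd_mult_left)
  \<comment> \<open>Numerators divide \<open>u^2\<close> or \<open>(u - 1)^2\<close>, while
    denominators divide \<mu> or \<open>M\<close>. As \<open>M\<close> is coprime to
    \<open>u\<close> and \<mu> to \<open>u - 1\<close>, nothing cancels crosswise.\<close>
  have cross: "no_cancelation x x'"
    if "x\<^sup>2 * of_nat \<mu> = of_int (int k)" "int k dvd u\<^sup>2"
      "x'\<^sup>2 * of_nat M = of_int (int k')" "int k' dvd (u - 1)\<^sup>2" for x x' k k'
  proof (rule no_cancelationI)
    show "coprime (fst (quotient_of x)) (rat_denom x')"
      using coprime_divisors[OF dvd_trans[OF num(1)[OF that(1)] that(2)] num(2)[OF that(3)] uu(2)]
      by simp
    show "coprime (fst (quotient_of x')) (rat_denom x)"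
      using coprime_divisors[OF dvd_trans[OF num(1)[OF that(3)] that(4)] num(2)[OF that(1)]]
        uu(3)[unfolded coprime_commute[of "int \<mu>"]] by simp
  qed
  have sym: "no_cancelation x x'" if "no_cancelation x' x" for x x'
    using that by (simp add: no_cancelation_def mult.commute)
  have free: "cancelation_free a b c d"
    unfolding cancelation_free_def
    using cross[OF sqs(1) dvd(1) sqs(3) dvd(3)] cross[OF sqs(1) dvd(1) sqs(4) dvd(4)]
      cross[OF sqs(2) dvd(2) sqs(3) dvd(3)] cross[OF sqs(2) dvd(2) sqs(4) dvd(4)] sym by blast

  have frac: "in_frac \<sigma> x \<and> in_frac \<sigma> x'"
    if xx': "of_rat (x * x' * of_nat \<sigma>) \<in> (\<int> :: real set)" "no_cancelation x x'" for x x'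
  proof -
    obtain k where "of_rat (x * x' * of_nat \<sigma>) = (of_int k :: real)"
      using xx'(1) by (rule Ints_cases)
    then have "of_rat (x * x' * of_nat \<sigma>) = (of_rat (of_int k) :: real)"
      by (simp only: of_rat_of_int_eq)
    then have "x * x' * of_nat \<sigma> = of_int k" by (simp only: of_rat_eq_iff)
    then have "in_frac \<sigma> (x * x')" by (simp add: in_frac_def mult.commute)
    then show ?thesis using xx'(2) unfolding in_frac_iff no_cancelation_def
      by (auto dest: dvd_mult_left dvd_mult_right)
  qed
  have "of_rat (a * b * of_nat \<sigma>) = \<alpha> * \<beta> * of_nat \<sigma>"
    using nz by (simp add: of_rat_mult flip: a b)
  moreover have "of_rat (c * d * of_nat \<sigma>) = \<gamma> * \<delta> / of_nat N * of_nat \<sigma>"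
    using nz by (simp add: of_rat_mult NM field_simps flip: c d)
  ultimately have "in_frac \<sigma> a" "in_frac \<sigma> b" "in_frac \<sigma> c" "in_frac \<sigma> d"
    using frac[of a b] frac[of c d] \<sigma> free unfolding cancelation_free_def by auto
  moreover have "mat2 \<alpha> \<beta> \<gamma> \<delta> \<in> Gamma0_star_full N"
    unfolding Gamma0_star_full_def mem_Collect_eq mat2_in_SL2R_iff using pres det by blast
  ultimately show ?thesis unfolding Gamma0_star_def using pres free by blast
qed

subsection \<open>The normalizer\<close>

context residue_subgroup
begin

section \<open>Integrality of the entries of a normalizing matrix\<close>

lemma conj_intoD:
  assumes "conj_into \<alpha> \<beta> \<gamma> \<delta>" "e \<in> reps" "h \<in> reps" "e * h - f * (int N * g) = 1"
  obtains x y z where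
    "of_int x = \<alpha>*\<delta> * of_int e - \<beta>*\<gamma> * of_int h + \<beta>*\<delta> * of_nat N * of_int g - \<alpha>*\<gamma> * of_int f" "x \<in> reps"
    "of_int y = \<alpha>*\<beta> * of_int (h - e) + \<alpha>\<^sup>2 * of_int f - \<beta>\<^sup>2 * of_nat N * of_int g"
    "of_nat N * of_int z = \<gamma>*\<delta> * of_int (e - h) + \<delta>\<^sup>2 * of_nat N * of_int g - \<gamma>\<^sup>2 * of_int f"
proof -
  have "mat2 \<alpha> \<beta> \<gamma> \<delta> ** mat2 (of_int e) (of_int f) (of_int (int N * g)) (of_int h) **
       mat2 \<delta> (- \<beta>) (- \<gamma>) \<alpha> \<in> Gamma_H N H"
    using assms unfolding conj_into_def by blast
  then obtain a b c d where
      "\<alpha> * \<delta> * of_int e - \<beta> * \<gamma> * of_int h + \<beta> * \<delta> * of_int (int N * g) - \<alpha> * \<gamma> * of_int f = of_int a"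
      "\<alpha> * \<beta> * (of_int h - of_int e) + \<alpha>\<^sup>2 * of_int f - \<beta>\<^sup>2 * of_int (int N * g) = of_int b"
      "\<gamma> * \<delta> * (of_int e - of_int h) + \<delta>\<^sup>2 * of_int (int N * g) - \<gamma>\<^sup>2 * of_int f = of_int (int N * c)"
      "a \<in> reps"
    unfolding mat2_conj mat2_in_Gamma_H_iff by blast
  then show thesis by (intro that[of a b c]) (simp_all add: mult.assoc)
qed

text \<open>The matrices with rows \<open>(1, 0)\<close> and \<open>(N * j, 1)\<close> are
  conjugated. The case \<open>j = 1\<close> gives the integrality statements; the upper left entries
  for all \<open>j\<close> give the elements of \<open>reps\<close>.\<close>

lemma conj_into_lower_unipotent:
  assumes "conj_into \<alpha> \<beta> \<gamma> \<delta>" "\<alpha> * \<delta> - \<beta> * \<gamma> = 1"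
  shows "\<beta>\<^sup>2 * of_nat N \<in> \<int>" "\<delta>\<^sup>2 \<in> \<int>"
    and "\<exists>z. \<beta> * \<delta> * of_nat N = of_int z \<and> (\<forall>j. 1 + j * z \<in> reps)"
proof -
  have N: "real N \<noteq> 0" using N_pos by simp
  have *: "\<exists>x y z. of_int x = 1 + \<beta>*\<delta> * of_nat N * of_int j \<and> x \<in> reps \<and>
      of_int y = \<beta>\<^sup>2 * of_nat N * of_int j \<and> of_int z = \<delta>\<^sup>2 * of_int j" for j
  proof -
    obtain x y z where
      "of_int x = \<alpha>*\<delta> * of_int 1 - \<beta>*\<gamma> * of_int 1 + \<beta>*\<delta> * of_nat N * of_int j - \<alpha>*\<gamma> * of_int 0"
      "x \<in> reps"
      "of_int y = \<alpha>*\<beta> * of_int (1 - 1) + \<alpha>\<^sup>2 * of_int 0 - \<beta>\<^sup>2 * of_nat N * of_int j"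
      "of_nat N * of_int z = \<gamma>*\<delta> * of_int (1 - 1) + \<delta>\<^sup>2 * of_nat N * of_int j - \<gamma>\<^sup>2 * of_int 0"
      by (rule conj_intoD[OF assms(1) reps_one reps_one, of 0 j]) auto
    then have "of_int x = 1 + \<beta>*\<delta> * of_nat N * of_int j \<and> x \<in> reps \<and>
      of_int (- y) = \<beta>\<^sup>2 * of_nat N * of_int j \<and> of_int z = \<delta>\<^sup>2 * of_int j"
      using assms(2) N by (simp add: mult.commute mult.left_commute)
    then show ?thesis by blast
  qed
  show "\<beta>\<^sup>2 * of_nat N \<in> \<int>" "\<delta>\<^sup>2 \<in> \<int>"
    using *[of 1] by (auto intro: Ints_of_int dest!: sym[of "of_int _"])
  obtain x where x: "of_int x = 1 + \<beta>*\<delta> * of_nat N * of_int 1" using *[of 1] by blast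
  then have z: "\<beta>*\<delta> * of_nat N = of_int (x - 1)" by simp
  have "1 + j * (x - 1) \<in> reps" for j
  proof -
    obtain x' where x': "of_int x' = 1 + \<beta>*\<delta> * of_nat N * of_int j" "x' \<in> reps" using *[of j] by blast
    have "(of_int x' :: real) = of_int (1 + j * (x - 1))" unfolding x'(1) z by simp
    then have "x' = 1 + j * (x - 1)" unfolding of_int_eq_iff .
    then show ?thesis using x'(2) by simp
  qed
  then show "\<exists>z. \<beta> * \<delta> * of_nat N = of_int z \<and> (\<forall>j. 1 + j * z \<in> reps)" using z by blast
qed

text \<open>Here the unipotents have upper right entry \<open>- j\<close>, so that the upper left
  entry of the conjugate is 1 plus, rather than minus, a multiple of \<alpha>\<gamma>.\<close>

lemma conj_into_upper_unipotent:
  assumes "conj_into \<alpha> \<beta> \<gamma> \<delta>" "\<alpha> * \<delta> - \<beta> * \<gamma> = 1"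
  shows "\<alpha>\<^sup>2 \<in> \<int>" "\<gamma>\<^sup>2 / of_nat N \<in> \<int>"
    and "\<exists>z. \<alpha> * \<gamma> = of_int z \<and> (\<forall>j. 1 + j * z \<in> reps)"
proof -
  have N: "real N \<noteq> 0" using N_pos by simp
  have *: "\<exists>x y z. of_int x = 1 + \<alpha>*\<gamma> * of_int j \<and> x \<in> reps \<and>
      of_int y = \<alpha>\<^sup>2 * of_int j \<and> of_int z = \<gamma>\<^sup>2 / of_nat N * of_int j" for j
  proof -
    obtain x y z where
      "of_int x = \<alpha>*\<delta> * of_int 1 - \<beta>*\<gamma> * of_int 1 + \<beta>*\<delta> * of_nat N * of_int 0 - \<alpha>*\<gamma> * of_int (- j)"
      "x \<in> reps"
      "of_int y = \<alpha>*\<beta> * of_int (1 - 1) + \<alpha>\<^sup>2 * of_int (- j) - \<beta>\<^sup>2 * of_nat N * of_int 0"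
      "of_nat N * of_int z = \<gamma>*\<delta> * of_int (1 - 1) + \<delta>\<^sup>2 * of_nat N * of_int 0 - \<gamma>\<^sup>2 * of_int (- j)"
      by (rule conj_intoD[OF assms(1) reps_one reps_one, of "- j" 0]) auto
    then have "of_int x = 1 + \<alpha>*\<gamma> * of_int j \<and> x \<in> reps \<and>
      of_int (- y) = \<alpha>\<^sup>2 * of_int j \<and> of_int z = \<gamma>\<^sup>2 / of_nat N * of_int j"
      using assms(2) N by (simp add: field_simps)
    then show ?thesis by blast
  qed
  show "\<alpha>\<^sup>2 \<in> \<int>" "\<gamma>\<^sup>2 / of_nat N \<in> \<int>"
    using *[of 1] by (auto intro: Ints_of_int dest!: sym[of "of_int _"])
  obtain x where x: "of_int x = 1 + \<alpha>*\<gamma> * of_int 1" using *[of 1] by blast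
  then have z: "\<alpha>*\<gamma> = of_int (x - 1)" by simp
  have "1 + j * (x - 1) \<in> reps" for j
  proof -
    obtain x' where x': "of_int x' = 1 + \<alpha>*\<gamma> * of_int j" "x' \<in> reps" using *[of j] by blast
    have "(of_int x' :: real) = of_int (1 + j * (x - 1))" unfolding x'(1) z by simp
    then have "x' = 1 + j * (x - 1)" unfolding of_int_eq_iff .
    then show ?thesis using x'(2) by simp
  qed
  then show "\<exists>z. \<alpha> * \<gamma> = of_int z \<and> (\<forall>j. 1 + j * z \<in> reps)" using z by blast
qed

lemma normalizer_subset_Gamma0_star:
  assumes "A \<in> normalizer SL2R (Gamma_H N H)"
  shows "A \<in> Gamma0_star N (sigma_H N H)"
proof -
  obtain \<alpha> \<beta> \<gamma> \<delta> where A: "A = mat2 \<alpha> \<beta> \<gamma> \<delta>" by (rule mat2_exhaust)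
  have N: "real N \<noteq> 0" using N_pos by simp
  let ?K = "K_H N H"
  have K: "?K dvd N" "?K > 0"
    using admissible_K_H N_pos unfolding admissible_def by (auto intro: dvd_pos_nat)
  have det: "\<alpha> * \<delta> - \<beta> * \<gamma> = 1"
    using assms unfolding A normalizer_def stabilizer_def by (simp add: mat2_in_SL2R_iff)
  have conj: "conj_into \<alpha> \<beta> \<gamma> \<delta>" "conj_into \<delta> (- \<beta>) (- \<gamma>) \<alpha>"
    using assms mem_normalizer_Gamma_H_iff[OF det] unfolding A by auto
  have det': "\<delta> * \<alpha> - (- \<beta>) * (- \<gamma>) = 1" using det by (simp add: mult.commute)
  note lower = conj_into_lower_unipotent[OF conj(1) det]
  note lower' = conj_into_lower_unipotent[OF conj(2) det']
  note upper = conj_into_upper_unipotent[OF conj(1) det]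
  note upper' = conj_into_upper_unipotent[OF conj(2) det']
  obtain p q r w where ints: "\<alpha>\<^sup>2 = of_int p" "\<delta>\<^sup>2 = of_int q" "\<beta>\<^sup>2 * of_nat N = of_int r"
      "\<gamma>\<^sup>2 / of_nat N = of_int w"
    using upper(1,2) lower(1,2) by (auto elim!: Ints_cases)
  \<comment> \<open>Inversion exchanges \<alpha> and \<delta>, so the unipotents conjugated by the
    inverse yield \<gamma>\<delta> and \<alpha>\<beta>N up to sign.\<close>
  obtain x where x: "\<delta> * (- \<gamma>) = of_int x" "\<And>j. 1 + j * x \<in> reps" using upper'(3) by blast
  obtain y where y: "- \<beta> * \<alpha> * of_nat N = of_int y" "\<And>j. 1 + j * y \<in> reps" using lower'(3) by blast

  have "(of_int (x\<^sup>2) :: real) = \<delta>\<^sup>2 * (\<gamma>\<^sup>2 / of_nat N) * of_nat N"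
    using N by (simp add: power_mult_distrib flip: x(1))
  also have "\<dots> = of_int (int N * (q * w))" unfolding ints by simp
  finally have "x\<^sup>2 = int N * (q * w)" unfolding of_int_eq_iff .
  then have "int ?K dvd x"
    using K_H_dvd_of_unipotents square_part_mult_squarefree_part_dvd_of_square N_pos x(2) by blast
  then obtain x' where x': "x = int ?K * x'" ..
  have "(of_int (y\<^sup>2) :: real) = \<alpha>\<^sup>2 * (\<beta>\<^sup>2 * of_nat N) * of_nat N"
    by (simp add: power_mult_distrib power2_eq_square[of "real N"] flip: y(1))
  also have "\<dots> = of_int (int N * (p * r))" unfolding ints by simp
  finally have "y\<^sup>2 = int N * (p * r)" unfolding of_int_eq_iff .
  then have "int ?K dvd y"
    using K_H_dvd_of_unipotents square_part_mult_squarefree_part_dvd_of_square N_pos y(2) by blast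
  then obtain y' where y': "y = int ?K * y'" ..

  \<comment> \<open>Divisibility by \<open>K_H\<close> turns into the denominator bound
    \<open>N div ?K\<close>, one of the two arguments of the gcd defining \<open>sigma_H\<close>;
    \<open>diff\<close> prepares the other.\<close>
  have NK: "real (N div ?K) = real N / real ?K" using K by (simp add: real_of_nat_div)
  have cd: "\<gamma> * \<delta> / of_nat N * of_nat (N div ?K) = of_int (- x')"
    using x(1) N K(2) unfolding NK x' by (simp add: field_simps)
  have ab: "\<alpha> * \<beta> * of_nat (N div ?K) = of_int (- y')"
    using y(1) N K(2) unfolding NK y' by (simp add: field_simps)
  have diff: "\<alpha> * \<beta> * of_int (e - h) \<in> \<int> \<and> \<gamma> * \<delta> / of_nat N * of_int (e - h) \<in> \<int>"
    if inv: "inverse_reps N H e h" for e h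
  proof -
    have eh: "e \<in> reps" "h \<in> reps" "[e * h = 1] (mod int N)" using inv by (auto simp: inverse_reps_iff)
    \<comment> \<open>Upper right entry 1 and lower left entry \<open>N * g\<close> complete the
      diagonal \<open>e\<close>, \<open>h\<close> to an element of \<open>Gamma_H\<close>. Their
      contributions to the off-diagonal entries of the conjugate are already known to be integral,
      respectively multiples of \<open>N\<close>.\<close>
    obtain g where "e * h - 1 = int N * g" using eh(3) by (auto simp: cong_iff_dvd_diff)
    then have g: "e * h - 1 * (int N * g) = 1" by simp
    obtain X Y Z where
      "of_int Y = \<alpha>*\<beta> * of_int (h - e) + \<alpha>\<^sup>2 * of_int 1 - \<beta>\<^sup>2 * of_nat N * of_int g"
      "of_nat N * of_int Z = \<gamma>*\<delta> * of_int (e - h) + \<delta>\<^sup>2 * of_nat N * of_int g - \<gamma>\<^sup>2 * of_int 1"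
      by (rule conj_intoD[OF conj(1) eh(1,2) g])
    moreover have "\<gamma>\<^sup>2 = of_nat N * of_int w" using ints(4) N by (simp add: field_simps)
    ultimately have "\<alpha> * \<beta> * of_int (e - h) = of_int (p - r * g - Y)"
        "\<gamma> * \<delta> * of_int (e - h) = of_nat N * of_int (Z - q * g + w)"
      using ints N by (simp_all add: algebra_simps)
    then have "\<alpha> * \<beta> * of_int (e - h) = of_int (p - r * g - Y)"
        "\<gamma> * \<delta> / of_nat N * of_int (e - h) = of_int (Z - q * g + w)"
      using N by simp_all
    then show ?thesis by (simp only: Ints_of_int simp_thms)
  qed
  have \<sigma>: "\<alpha> * \<beta> * of_nat (sigma_H N H) \<in> \<int>" "\<gamma> * \<delta> / of_nat N * of_nat (sigma_H N H) \<in> \<int>"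
    by (rule of_nat_mult_sigma_H; simp only: diff ab cd Ints_of_int)+

  obtain z where z: "\<beta> * \<delta> * of_nat N = of_int z" using lower(3) by blast
  obtain t where t: "\<alpha> * \<gamma> = of_int t" using upper(3) by blast
  \<comment> \<open>The pair \<open>1 + N\<close>, \<open>1\<close> makes \<alpha>\<delta>N an
    integer, so \<alpha>\<delta> is rational; its square \<open>p * q\<close> is an integer, so it
    is itself an integer.\<close>
  have "\<alpha> * \<delta> \<in> \<int>"
  proof -
    have eh: "1 + int N \<in> reps" "1 \<in> reps" "(1 + int N) * 1 - 1 * (int N * 1) = 1"
      using inverse_reps_one_plus by (auto simp: inverse_reps_iff)
    have bc: "\<beta> * \<gamma> = \<alpha> * \<delta> - 1" using det by simp
    obtain X where
      X: "of_int X = \<alpha>*\<delta> * of_int (1 + int N) - \<beta>*\<gamma> * of_int 1 +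
          \<beta>*\<delta> * of_nat N * of_int 1 - \<alpha>*\<gamma> * of_int 1"
      by (rule conj_intoD[OF conj(1) eh])
    have "\<alpha> * \<delta> * of_nat N = of_int (X - 1 - z + t)"
      using X[unfolded bc z t] by (simp add: algebra_simps)
    then obtain k where "\<alpha> * \<delta> * of_nat N = of_int k" by blast
    then have "\<alpha> * \<delta> = of_rat (of_int k / of_nat N)"
      using N by (simp add: of_rat_divide field_simps)
    then obtain u where u: "\<alpha> * \<delta> = of_rat u" by blast
    have "of_rat (u\<^sup>2 * of_nat 1) = (of_rat (of_int (p * q)) :: real)"
      using ints(1,2) by (simp add: of_rat_power of_rat_mult power_mult_distrib flip: u)
    then have "u\<^sup>2 * of_nat 1 = of_int (p * q)" unfolding of_rat_eq_iff .
    \<comment> \<open>The square part of 1 is 1, so membership in this fraction set is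
      integrality.\<close>
    then have "in_frac (square_part 1) u" by (rule in_frac_square_partI)
    then have "u \<in> \<int>" by (simp add: in_frac_def)
    then show ?thesis unfolding u by (rule of_rat_Ints)
  qed
  then show ?thesis
    unfolding A
    using Gamma0_starI[OF N_pos det upper(1) lower(2) lower(1) upper(2) _ _ _ \<sigma>] z t by auto
qed

section \<open>The criterion in terms of inverse representatives\<close>

lemma conj_into_iff:
  assumes ent: "star_entries N (sigma_H N H) \<alpha> \<beta> \<gamma> \<delta>" and u: "\<alpha> * \<delta> = of_int u"
  shows "conj_into \<alpha> \<beta> \<gamma> \<delta> \<longleftrightarrow>
    (\<forall>e h. inverse_reps N H e h \<longrightarrow> inverse_reps N H (u * e - (u - 1) * h) (u * h - (u - 1) * e))"
proof -
  let ?\<sigma> = "sigma_H N H" and ?K = "K_H N H"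
  text \<open>The diagonal entries of a conjugate are \<open>E e h\<close> and \<open>E h e\<close> up to multiples of \<open>K\<^sub>H\<close>, and these
    two numbers are inverse modulo \<open>N\<close> because \<open>\<sigma>\<close> divides \<open>e - h\<close>.\<close>
  define E where "E e h = u * e - (u - 1) * h" for e h
  have N: "real N \<noteq> 0" using N_pos by simp
  have K: "?K dvd N" "?K > 0"
    using admissible_K_H N_pos unfolding admissible_def by (auto intro: dvd_pos_nat)
  have det: "\<alpha> * \<delta> - \<beta> * \<gamma> = 1" using ent by (simp add: star_entries_def)
  have v: "\<beta> * \<gamma> = of_int (u - 1)" using det u by simp
  obtain p q r w where ints: "\<alpha>\<^sup>2 = of_int p" "\<delta>\<^sup>2 = of_int q" "\<beta>\<^sup>2 * of_nat N = of_int r"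
      "\<gamma>\<^sup>2 / of_nat N = of_int w"
    using ent unfolding star_entries_def by (auto elim!: Ints_cases)
  have w: "\<gamma>\<^sup>2 = of_nat N * of_int w" using ints(4) N by (simp add: field_simps)
  obtain i j where ij: "\<alpha> * \<beta> * of_nat ?\<sigma> = of_int i" "\<gamma> * \<delta> / of_nat N * of_nat ?\<sigma> = of_int j"
    using ent unfolding star_entries_def by (auto elim!: Ints_cases)
  have j: "\<gamma> * \<delta> * of_nat ?\<sigma> = of_nat N * of_int j" using ij(2) N by (simp add: field_simps)
  obtain k l where kl: "\<alpha> * \<gamma> / of_nat N * of_nat ?\<sigma> = of_int k" "\<beta> * \<delta> * of_nat ?\<sigma> = of_int l"
    using ent unfolding star_entries_def by (auto elim!: Ints_cases)
  have k: "\<alpha> * \<gamma> * of_nat ?\<sigma> = of_nat N * of_int k" using kl(1) N by (simp add: field_simps)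

  \<comment> \<open>Since \<sigma> divides \<open>N div ?K\<close>, the \<sigma>-bounds on
    \<alpha>\<gamma>/N and \<beta>\<delta> make \<alpha>\<gamma> and \<beta>\<delta>N integer
    multiples of \<open>?K\<close>.\<close>
  obtain n where n: "N = ?K * (?\<sigma> * n)"
  proof -
    have "?\<sigma> dvd N div ?K" unfolding sigma_H_def by simp
    then show thesis using that K(1) by (metis dvdE dvd_mult_div_cancel)
  qed
  have Nn: "real N = real ?K * (real ?\<sigma> * real n)"
    using arg_cong[OF n, of real] by simp
  have \<sigma>: "real ?\<sigma> \<noteq> 0" using N Nn by auto
  have "\<alpha> * \<gamma> * real ?\<sigma> = of_int (int ?K * (int n * k)) * real ?\<sigma>"
    unfolding k Nn by simp
  then have ac: "\<alpha> * \<gamma> = of_int (int ?K * (int n * k))" using \<sigma> by simp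
  have "\<beta> * \<delta> * real N = real ?K * real n * (\<beta> * \<delta> * real ?\<sigma>)"
    unfolding Nn by simp
  then have bd: "\<beta> * \<delta> * real N = of_int (int ?K * (int n * l))"
    unfolding kl(2) by simp

  have diff: "\<exists>X Y. \<alpha> * \<beta> * of_int (e - h) = of_int X \<and> \<gamma> * \<delta> * of_int (e - h) = of_nat N * of_int Y"
    if inv: "inverse_reps N H e h" for e h
  proof -
    obtain m where m: "e - h = int ?\<sigma> * m" using sigma_H_dvd_diff[OF inv] ..
    have "\<alpha> * \<beta> * of_int (e - h) = of_int (i * m)" unfolding m using ij(1) by simp
    moreover have "\<gamma> * \<delta> * of_int (e - h) = of_nat N * of_int (j * m)" unfolding m using j by simp
    ultimately show ?thesis by blast
  qed

  have E_mult: "[E e h * E h e = 1] (mod int N)" if inv: "inverse_reps N H e h" for e h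
  proof -
    obtain X Y where XY: "\<alpha> * \<beta> * of_int (e - h) = of_int X"
        "\<gamma> * \<delta> * of_int (e - h) = of_nat N * of_int Y"
      using diff[OF inv] by blast
    \<comment> \<open>Regrouping \<alpha>\<delta> and \<beta>\<gamma> as \<alpha>\<beta> and
      \<gamma>\<delta> distributes one factor \<open>e - h\<close> to each; the first product is
      then an integer and the second a multiple of \<open>N\<close>.\<close>
    have "(of_int (u * (u - 1) * (e - h)\<^sup>2) :: real) =
        (\<alpha> * \<beta> * of_int (e - h)) * (\<gamma> * \<delta> * of_int (e - h))"
      unfolding of_int_mult u[symmetric] v[symmetric] by (simp add: power2_eq_square)
    also have "\<dots> = of_int (int N * (X * Y))" unfolding XY by simp
    finally have uv: "u * (u - 1) * (e - h)\<^sup>2 = int N * (X * Y)" unfolding of_int_eq_iff .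
    have "E e h * E h e = e * h - u * (u - 1) * (e - h)\<^sup>2"
      unfolding E_def by (simp add: algebra_simps power2_eq_square)
    then have "[E e h * E h e = e * h] (mod int N)" unfolding uv by (simp add: cong_iff_dvd_diff)
    then show ?thesis using inv cong_trans unfolding inverse_reps_iff by blast
  qed

  have corner: "of_int (E e h + int ?K * (int n * (l * g - k * f))) =
      \<alpha> * \<delta> * of_int e - \<beta> * \<gamma> * of_int h + \<beta> * \<delta> * of_nat N * of_int g - \<alpha> * \<gamma> * of_int f"
    for e f g h
    unfolding u v ac bd E_def by (simp add: algebra_simps)
  have corner_reps: "E e h + int ?K * y \<in> reps \<longleftrightarrow> E e h \<in> reps" for e h y
    using reps_cong_admissible[OF admissible_K_H, of "E e h" "E e h + int ?K * y"]
      reps_cong_admissible[OF admissible_K_H, of "E e h + int ?K * y" "E e h"]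
    by (auto simp: cong_iff_dvd_diff)

  show ?thesis unfolding E_def[symmetric]
  proof
    assume conj: "conj_into \<alpha> \<beta> \<gamma> \<delta>"
    have E_reps: "E e h \<in> reps" if inv: "inverse_reps N H e h" for e h
    proof -
      have eh: "e \<in> reps" "h \<in> reps"
          "[e * h = 1] (mod int N)" using inv by (auto simp: inverse_reps_iff)
      obtain g where "e * h - 1 = int N * g" using eh(3) by (auto simp: cong_iff_dvd_diff)
      then have g: "e * h - 1 * (int N * g) = 1" by simp
      obtain x where x: "of_int x = \<alpha> * \<delta> * of_int e - \<beta> * \<gamma> * of_int h +
          \<beta> * \<delta> * of_nat N * of_int g - \<alpha> * \<gamma> * of_int 1"
          "x \<in> reps"
        by (rule conj_intoD[OF conj eh(1,2) g])
      have "x = E e h + int ?K * (int n * (l * g - k * 1))"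
        using x(1) unfolding corner[symmetric] of_int_eq_iff .
      then show ?thesis using x(2) corner_reps by simp
    qed
    show "\<forall>e h. inverse_reps N H e h \<longrightarrow> inverse_reps N H (E e h) (E h e)"
    proof (intro allI impI)
      fix e h assume inv: "inverse_reps N H e h"
      then have "inverse_reps N H h e" by (simp add: inverse_reps_iff mult.commute)
      then show "inverse_reps N H (E e h) (E h e)"
        using E_reps E_mult[OF inv] inv unfolding inverse_reps_iff[of "E e h"] by blast
    qed
  next
    assume R: "\<forall>e h. inverse_reps N H e h \<longrightarrow> inverse_reps N H (E e h) (E h e)"
    show "conj_into \<alpha> \<beta> \<gamma> \<delta>"
      unfolding conj_into_def
    proof (intro allI impI)
      fix e f g h
      assume eh: "e \<in> reps" "h \<in> reps" "e * h - f * (int N * g) = 1"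
      let ?M = "mat2 \<alpha> \<beta> \<gamma> \<delta> ** mat2 (of_int e) (of_int f) (of_int (int N * g)) (of_int h) **
          mat2 \<delta> (- \<beta>) (- \<gamma>) \<alpha>"
      have "e * h - 1 = int N * (f * g)" using eh(3) by (simp add: algebra_simps)
      then have inv: "inverse_reps N H e h" using eh by (simp add: inverse_reps_iff cong_iff_dvd_diff)
      then have "inverse_reps N H (E e h) (E h e)" using R by blast
      then have reps: "E e h \<in> reps" "E h e \<in> reps" by (auto simp: inverse_reps_iff)
      obtain X Y where XY: "\<alpha> * \<beta> * of_int (e - h) = of_int X"
          "\<gamma> * \<delta> * of_int (e - h) = of_nat N * of_int Y"
        using diff[OF inv] by blast
      define a where "a = E e h + int ?K * (int n * (l * g - k * f))"
      \<comment> \<open>The lower right corner is the upper left one with \<open>e\<close>,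
        \<open>h\<close> exchanged and \<open>f\<close>, \<open>g\<close> negated, so
        \<open>corner\<close> covers both.\<close>
      define d where "d = E h e + int ?K * (int n * (l * (- g) - k * (- f)))"
      define b where "b = p * f - X - r * g"
      define c where "c = Y + q * g - w * f"
      have "a \<in> reps" "d \<in> reps" unfolding a_def d_def using reps corner_reps by blast+
      have M: "?M = mat2 (of_int a) (of_int b) (of_int (int N * c)) (of_int d)"
        unfolding mat2_conj mat2_eq_iff a_def b_def c_def d_def corner
        using XY ints w by (simp add: algebra_simps)
      \<comment> \<open>Multiplicativity of the determinant replaces a direct expansion of
        \<open>a * d - b * (N * c)\<close>.\<close>
      have "mat2 (of_int e) (of_int f) (of_int (int N * g)) (of_int h) \<in> carrier SL2R"
        "mat2 \<alpha> \<beta> \<gamma> \<delta> \<in> carrier SL2R" "mat2 \<delta> (- \<beta>) (- \<gamma>) \<alpha> \<in> carrier SL2R"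
        unfolding mat2_in_SL2R_iff using det arg_cong[OF eh(3), of "of_int :: int \<Rightarrow> real"]
        by (simp_all add: mult.commute)
      then have "?M \<in> carrier SL2R" by (simp add: SL2R_def det_mul)
      then have "of_int (a * d - b * (int N * c)) = (of_int 1 :: real)"
        unfolding M mat2_in_SL2R_iff by simp
      then have "a * d - b * (int N * c) = 1" unfolding of_int_eq_iff .
      then show "?M \<in> Gamma_H N H"
        unfolding M mat2_in_Gamma_H_iff using \<open>a \<in> reps\<close> \<open>d \<in> reps\<close> by blast
    qed
  qed
qed

text \<open>Inversion exchanges \<alpha> and \<delta> and so preserves \<open>u\<close>; hence both
  halves of the normalizer condition reduce to the same criterion.\<close>

lemma mem_normalizer_iff_inverse_reps:
  assumes "star_entries N (sigma_H N H) \<alpha> \<beta> \<gamma> \<delta>" and "\<alpha> * \<delta> = of_int u"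
  shows "mat2 \<alpha> \<beta> \<gamma> \<delta> \<in> normalizer SL2R (Gamma_H N H) \<longleftrightarrow>
    (\<forall>e h. inverse_reps N H e h \<longrightarrow> inverse_reps N H (u * e - (u - 1) * h) (u * h - (u - 1) * e))"
proof -
  have "\<alpha> * \<delta> - \<beta> * \<gamma> = 1" using assms(1) by (simp add: star_entries_def)
  moreover have "\<delta> * \<alpha> = of_int u" using assms(2) by (simp add: mult.commute)
  ultimately show ?thesis
    using conj_into_iff[OF assms] conj_into_iff[OF star_entries_inv[OF assms(1)]]
    by (simp add: mem_normalizer_Gamma_H_iff)
qed

end

theorem corollary2p6:
  fixes N :: nat and H :: "int set set"
  assumes "N > 0" and "subgroup H (residue_units N)"
  shows "normalizer SL2R (Gamma_H N H) \<subseteq> Gamma0_star N (sigma_H N H) \<and>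
    (\<forall>A \<in> Gamma0_star N (sigma_H N H). \<forall>\<mu> a b c d. is_presentation N A \<mu> a b c d \<longrightarrow>
       (A \<in> normalizer SL2R (Gamma_H N H) \<longleftrightarrow>
         (\<forall>e h :: int. inverse_reps N H e h \<longrightarrow>
           (\<exists>e' h' :: int.
              of_int e' = a * d * of_int e * of_nat \<mu> - b * c * of_int h * of_nat (N div \<mu>) \<and>
              of_int h' = a * d * of_int h * of_nat \<mu> - b * c * of_int e * of_nat (N div \<mu>) \<and>
              inverse_reps N H e' h'))))"
proof (intro conjI ballI allI impI)
  interpret residue_subgroup N H using assms by (rule residue_subgroup.intro)
  show "normalizer SL2R (Gamma_H N H) \<subseteq> Gamma0_star N (sigma_H N H)"
    using normalizer_subset_Gamma0_star by blast
  fix A \<mu> a b c d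
  assume A: "A \<in> Gamma0_star N (sigma_H N H)" and pres: "is_presentation N A \<mu> a b c d"
  obtain \<alpha> \<beta> \<gamma> \<delta> where A_eq: "A = mat2 \<alpha> \<beta> \<gamma> \<delta>" by (rule mat2_exhaust)
  have ent: "star_entries N (sigma_H N H) \<alpha> \<beta> \<gamma> \<delta>"
    using Gamma0_star_imp_star_entries[OF N_pos] A unfolding A_eq by blast
  then obtain u where u: "\<alpha> * \<delta> = of_int u" unfolding star_entries_def by (auto elim: Ints_cases)
  have v: "\<beta> * \<gamma> = of_int (u - 1)" using ent u by (simp add: star_entries_def)
  have \<mu>: "real \<mu> > 0"
    using pres N_pos unfolding is_presentation_def exact_divisor_def by (auto intro: dvd_pos_nat)
  have eq: "\<alpha> = of_rat a * sqrt (real \<mu>)" "\<beta> = of_rat b / sqrt (real \<mu>)"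
      "\<gamma> = of_rat c * real (N div \<mu>) * sqrt (real \<mu>)" "\<delta> = of_rat d * sqrt (real \<mu>)"
    using pres unfolding is_presentation_def A_eq mat2_eq_iff by blast+
  \<comment> \<open>The two coefficients of the criterion are \<alpha>\<delta> and \<beta>\<gamma>,
    that is \<open>u\<close> and \<open>u - 1\<close>, whatever the presentation; this also forces
    the integers \<open>e'\<close> and \<open>h'\<close>.\<close>
  have "of_rat (a * d * of_nat \<mu>) = \<alpha> * \<delta>" unfolding eq by (simp add: of_rat_mult)
  then have "of_rat (a * d * of_nat \<mu>) = (of_rat (of_int u) :: real)" using u by simp
  then have ad: "a * d * of_nat \<mu> = of_int u" unfolding of_rat_eq_iff .
  have "of_rat (b * c * of_nat (N div \<mu>)) = \<beta> * \<gamma>" unfolding eq using \<mu> by (simp add: of_rat_mult)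
  then have "of_rat (b * c * of_nat (N div \<mu>)) = (of_rat (of_int (u - 1)) :: real)"
    unfolding v by (simp only: of_rat_of_int_eq)
  then have bc: "b * c * of_nat (N div \<mu>) = of_int (u - 1)" unfolding of_rat_eq_iff .
  have E: "a * d * of_int e * of_nat \<mu> - b * c * of_int h * of_nat (N div \<mu>) =
      of_int (u * e - (u - 1) * h)" for e h
  proof -
    have "a * d * of_int e * of_nat \<mu> - b * c * of_int h * of_nat (N div \<mu>) =
        a * d * of_nat \<mu> * of_int e - b * c * of_nat (N div \<mu>) * of_int h"
      by (simp only: mult_ac)
    then show ?thesis unfolding ad bc by simp
  qed
  show "A \<in> normalizer SL2R (Gamma_H N H) \<longleftrightarrow>
         (\<forall>e h :: int. inverse_reps N H e h \<longrightarrow>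
           (\<exists>e' h' :: int.
              of_int e' = a * d * of_int e * of_nat \<mu> - b * c * of_int h * of_nat (N div \<mu>) \<and>
              of_int h' = a * d * of_int h * of_nat \<mu> - b * c * of_int e * of_nat (N div \<mu>) \<and>
              inverse_reps N H e' h'))"
    unfolding E of_int_eq_iff A_eq mem_normalizer_iff_inverse_reps[OF ent u] by simp
qed

end
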